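(* Assume in addition that $S$ is positive definite. For any given stabilizing control gain $\hat K_1\in\mathbb{R}^{m\times n}$ and any $\epsilon>0$, there exist $\delta_2=\delta_2(\epsilon,\hat K_1)>0$, $\Pi=\Pi(\delta_2)>0$ and $\kappa=\kappa(\delta_2)>0$ such that for every sequence $\Delta G=\{\Delta G_i\}_{i\ge 1}$ in $\mathbb{S}^{m+n}$ with $\Vert\Delta G\Vert_\infty<\delta_2$, the inexact policy iteration started from $\hat K_1$ with disturbance $\Delta G$ satisfies, for all integers $i>0$: $[\hat G_i]_{uu}$ is invertible, $\hat K_i$ is stabilizing, $\Vert\tilde P_i\Vert_F<\Pi$, $\Vert\hat K_i\Vert_F<\kappa$; and $$\limsup_{i\to\infty}\Vert\tilde P_i-P^*\Vert_F<\epsilon.$$ If in addition $\lim_{i\to\infty}\Vert\Delta G_i\Vert_F=0$, then $\lim_{i\to\infty}\Vert\tilde P_i-P^*\Vert_F=0$.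
   Context: $\mathbb{S}^n$ is the set of real symmetric $n\times n$ matrices, $\Vert\cdot\Vert_F$ the Frobenius norm. $A\in\mathbb{R}^{n\times n}$, $B\in\mathbb{R}^{n\times m}$ with $(A,B)$ controllable; $S\in\mathbb{S}^n$ is positive semidefinite with $(A,S^{1/2})$ observable; $R\in\mathbb{S}^m$ is positive definite. A square matrix is stable if its spectral radius is $<1$; a gain $K\in\mathbb{R}^{m\times n}$ is stabilizing if $A-BK$ is stable. $P^*$ is the unique positive definite solution of $$A^TPA-P-A^TPB(R+B^TPB)^{-1}B^TPA+S=0.$$ For $P\in\mathbb{S}^n$ let $$G(P)=\begin{bmatrix} S+A^TPA-P & A^TPB\\ B^TPA & R+B^TPB\end{bmatrix}\in\mathbb{S}^{n+m},$$ and for $G\in\mathbb{S}^{n+m}$ write $[G]_{xx}$ (upper-left $n\times n$), $[G]_{ux}$ (lower-left $m\times n$), $[G]_{uu}$ (lower-right $m\times m$) for its blocks, and $\mathcal{H}(G,K)=[I_n,\,-K^T]\,G\,[I_n,\,-K^T]^T$. Inexact policy iteration: given a stabilizing $\hat K_1$ and disturbances $\Delta G_i\in\mathbb{S}^{m+n}$, for $i=1,2,\dots$: let $\tilde P_i\in\mathbb{S}^n$ be the solution of $\mathcal{H}(G(\tilde P_i),\hat K_i)=0$, i.e. of $(A-B\hat K_i)^T\tilde P_i(A-B\hat K_i)-\tilde P_i+S+\hat K_i^TR\hat K_i=0$ (unique when $\hat K_i$ is stabilizing); put $\tilde G_i=G(\tilde P_i)$, $\hat G_i=\tilde G_i+\Delta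 G_i$, and $\hat K_{i+1}=[\hat G_i]_{uu}^{-1}[\hat G_i]_{ux}$. $\Vert\Delta G\Vert_\infty=\sup_i\Vert\Delta G_i\Vert_F$. *)

theory Defs
  imports "HOL-Analysis.Analysis" "HOL-Library.Extended_Real"
begin

text \<open>
  A real $p \times q$ matrix is an element of \<open>real ^ 'q ^ 'p\<close>. On this type the library norm
  is the Frobenius norm:
\<close>

lemma norm_eq_Frobenius:
  fixes M :: "real ^ 'q ^ 'p"
  shows "norm M = sqrt (\<Sum>i\<in>UNIV. \<Sum>j\<in>UNIV. (M $ i $ j)\<^sup>2)"
  by (simp add: norm_vec_def L2_set_def real_sqrt_pow2 sum_nonneg)

definition sym_mat :: "real ^ 'n ^ 'n \<Rightarrow> bool" where
  "sym_mat M \<longleftrightarrow> transpose M = M"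

definition pos_semidef :: "real ^ 'n ^ 'n \<Rightarrow> bool" where
  "pos_semidef M \<longleftrightarrow> sym_mat M \<and> (\<forall>x. 0 \<le> x \<bullet> (M *v x))"

definition pos_def :: "real ^ 'n ^ 'n \<Rightarrow> bool" where
  "pos_def M \<longleftrightarrow> sym_mat M \<and> (\<forall>x. x \<noteq> 0 \<longrightarrow> 0 < x \<bullet> (M *v x))"

definition psd_sqrt :: "real ^ 'n ^ 'n \<Rightarrow> real ^ 'n ^ 'n" where
  "psd_sqrt M = (THE Q. pos_semidef Q \<and> Q ** Q = M)"

text \<open>
  The spectrum is taken over the complex numbers; it is finite and nonempty, being the set of
  roots of the characteristic polynomial.
\<close>

definition complex_spectrum :: "real ^ 'n ^ 'n \<Rightarrow> complex set" where
  "complex_spectrum M =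
     {z. \<exists>v :: complex ^ 'n. v \<noteq> 0 \<and> (\<chi> i j. complex_of_real (M $ i $ j)) *v v = z *s v}"

definition spec_radius :: "real ^ 'n ^ 'n \<Rightarrow> real" where
  "spec_radius M = Max (cmod ` complex_spectrum M)"

definition stable :: "real ^ 'n ^ 'n \<Rightarrow> bool" where
  "stable M \<longleftrightarrow> spec_radius M < 1"

definition stabilizing ::
    "real ^ 'n ^ 'n \<Rightarrow> real ^ 'm ^ 'n \<Rightarrow> real ^ 'n ^ 'm \<Rightarrow> bool" where
  "stabilizing A B K \<longleftrightarrow> stable (A - B ** K)"

text \<open>
  \<open>(A, B)\<close> is controllable if $x_{t+1} = A x_t + B u_t$ can be steered from any state to any
  other in finite time; \<open>(A, C)\<close> is observable if the output $C x_t$ of $x_{t+1} = A x_t$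
  determines the initial state.
\<close>

definition controllable :: "real ^ 'n ^ 'n \<Rightarrow> real ^ 'm ^ 'n \<Rightarrow> bool" where
  "controllable A B \<longleftrightarrow>
     (\<forall>x0 xf. \<exists>N (u :: nat \<Rightarrow> real ^ 'm) x.
        x 0 = x0 \<and> (\<forall>t<N. x (Suc t) = A *v x t + B *v u t) \<and> x N = xf)"

definition observable :: "real ^ 'n ^ 'n \<Rightarrow> real ^ 'n ^ 'p \<Rightarrow> bool" where
  "observable A C \<longleftrightarrow>
     (\<forall>x y. (\<forall>t::nat. x (Suc t) = A *v x t) \<and> (\<forall>t. y (Suc t) = A *v y t) \<and>
        (\<forall>t. C *v x t = C *v y t) \<longrightarrow> x 0 = y 0)"

definition dare_lhs :: "real ^ 'n ^ 'n \<Rightarrow> real ^ 'm ^ 'n \<Rightarrow> real ^ 'n ^ 'n \<Rightarrow> real ^ 'm ^ 'm \<Rightarrow>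
    real ^ 'n ^ 'n \<Rightarrow> real ^ 'n ^ 'n" where
  "dare_lhs A B S R P =
     transpose A ** P ** A - P
     - transpose A ** P ** B ** matrix_inv (R + transpose B ** P ** B) ** transpose B ** P ** A
     + S"

definition P_star :: "real ^ 'n ^ 'n \<Rightarrow> real ^ 'm ^ 'n \<Rightarrow> real ^ 'n ^ 'n \<Rightarrow> real ^ 'm ^ 'm \<Rightarrow>
    real ^ 'n ^ 'n" where
  "P_star A B S R = (THE P. pos_def P \<and> dare_lhs A B S R P = 0)"

text \<open>
  Matrices of order $n + m$ are indexed by the sum type \<open>'n + 'm\<close>; \<open>Inl\<close> marks the first
  (state, $x$) and \<open>Inr\<close> the second (input, $u$) index group.
\<close>

definition block_mat :: "real ^ 'n ^ 'n \<Rightarrow> real ^ 'm ^ 'n \<Rightarrow> real ^ 'n ^ 'm \<Rightarrow> real ^ 'm ^ 'm \<Rightarrow>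
    real ^ ('n::finite + 'm::finite) ^ ('n::finite + 'm::finite)" where
  "block_mat Mxx Mxu Mux Muu = (\<chi> i j.
     case i of
       Inl a \<Rightarrow> (case j of Inl b \<Rightarrow> Mxx $ a $ b | Inr d \<Rightarrow> Mxu $ a $ d)
     | Inr c \<Rightarrow> (case j of Inl b \<Rightarrow> Mux $ c $ b | Inr d \<Rightarrow> Muu $ c $ d))"

definition block_row :: "real ^ 'n ^ 'p \<Rightarrow> real ^ 'm ^ 'p \<Rightarrow> real ^ ('n::finite + 'm::finite) ^ 'p" where
  "block_row M N = (\<chi> i j. case j of Inl b \<Rightarrow> M $ i $ b | Inr d \<Rightarrow> N $ i $ d)"

definition block_ux :: "real ^ ('n::finite + 'm::finite) ^ ('n::finite + 'm::finite) \<Rightarrow> real ^ 'n ^ 'm" where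
  "block_ux G = (\<chi> i j. G $ Inr i $ Inl j)"

definition block_uu :: "real ^ ('n::finite + 'm::finite) ^ ('n::finite + 'm::finite) \<Rightarrow> real ^ 'm ^ 'm" where
  "block_uu G = (\<chi> i j. G $ Inr i $ Inr j)"

definition G_mat :: "real ^ 'n ^ 'n \<Rightarrow> real ^ 'm ^ 'n \<Rightarrow> real ^ 'n ^ 'n \<Rightarrow> real ^ 'm ^ 'm \<Rightarrow>
    real ^ 'n ^ 'n \<Rightarrow> real ^ ('n::finite + 'm::finite) ^ ('n::finite + 'm::finite)" where
  "G_mat A B S R P =
     block_mat (S + transpose A ** P ** A - P) (transpose A ** P ** B)
               (transpose B ** P ** A) (R + transpose B ** P ** B)"

definition H_map :: "real ^ ('n::finite + 'm::finite) ^ ('n::finite + 'm::finite) \<Rightarrow> real ^ 'n ^ 'm \<Rightarrow> real ^ 'n ^ 'n" where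
  "H_map G K =
     block_row (mat 1) (- transpose K) ** G ** transpose (block_row (mat 1) (- transpose K))"

definition policy_value :: "real ^ 'n ^ 'n \<Rightarrow> real ^ 'm ^ 'n \<Rightarrow> real ^ 'n ^ 'n \<Rightarrow> real ^ 'm ^ 'm \<Rightarrow>
    real ^ 'n ^ 'm \<Rightarrow> real ^ 'n ^ 'n" where
  "policy_value A B S R K = (THE P. sym_mat P \<and> H_map (G_mat A B S R P) K = 0)"

text \<open>
  The iteration is indexed from 1. \<open>K_hat\<close> at index 0 and the disturbance at index 0 play no
  role.
\<close>

primrec K_hat :: "real ^ 'n ^ 'n \<Rightarrow> real ^ 'm ^ 'n \<Rightarrow> real ^ 'n ^ 'n \<Rightarrow> real ^ 'm ^ 'm \<Rightarrow>
    real ^ 'n ^ 'm \<Rightarrow> (nat \<Rightarrow> real ^ ('n::finite + 'm::finite) ^ ('n::finite + 'm::finite)) \<Rightarrow> nat \<Rightarrow> real ^ 'n ^ 'm" where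
  "K_hat A B S R K1 \<Delta>G 0 = K1"
| "K_hat A B S R K1 \<Delta>G (Suc i) =
     (if i = 0 then K1
      else let G = G_mat A B S R (policy_value A B S R (K_hat A B S R K1 \<Delta>G i)) + \<Delta>G i
           in matrix_inv (block_uu G) ** block_ux G)"

definition P_tilde :: "real ^ 'n ^ 'n \<Rightarrow> real ^ 'm ^ 'n \<Rightarrow> real ^ 'n ^ 'n \<Rightarrow> real ^ 'm ^ 'm \<Rightarrow>
    real ^ 'n ^ 'm \<Rightarrow> (nat \<Rightarrow> real ^ ('n::finite + 'm::finite) ^ ('n::finite + 'm::finite)) \<Rightarrow> nat \<Rightarrow> real ^ 'n ^ 'n" where
  "P_tilde A B S R K1 \<Delta>G i = policy_value A B S R (K_hat A B S R K1 \<Delta>G i)"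

definition G_hat :: "real ^ 'n ^ 'n \<Rightarrow> real ^ 'm ^ 'n \<Rightarrow> real ^ 'n ^ 'n \<Rightarrow> real ^ 'm ^ 'm \<Rightarrow>
    real ^ 'n ^ 'm \<Rightarrow> (nat \<Rightarrow> real ^ ('n::finite + 'm::finite) ^ ('n::finite + 'm::finite)) \<Rightarrow> nat \<Rightarrow>
    real ^ ('n::finite + 'm::finite) ^ ('n::finite + 'm::finite)" where
  "G_hat A B S R K1 \<Delta>G i = G_mat A B S R (P_tilde A B S R K1 \<Delta>G i) + \<Delta>G i"

lemma K_hat_1: "K_hat A B S R K1 \<Delta>G 1 = K1"
  by simp

lemma K_hat_step:
  assumes "1 \<le> i"
  shows "K_hat A B S R K1 \<Delta>G (i + 1) =
    matrix_inv (block_uu (G_hat A B S R K1 \<Delta>G i)) ** block_ux (G_hat A B S R K1 \<Delta>G i)"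
  using assms by (simp add: G_hat_def P_tilde_def Let_def)

lemma sum_UNIV_Plus:
  fixes f :: "'n::finite + 'm::finite \<Rightarrow> real"
  shows "sum f UNIV = (\<Sum>i\<in>UNIV. f (Inl i)) + (\<Sum>i\<in>UNIV. f (Inr i))"
  unfolding UNIV_Plus_UNIV[symmetric] by (subst sum.Plus) auto

lemma block_row_times_block_mat:
  "block_row X Y ** block_mat Mxx Mxu Mux Muu =
     block_row (X ** Mxx + Y ** Mux) (X ** Mxu + Y ** Muu)"
  by (auto simp: vec_eq_iff block_row_def block_mat_def matrix_matrix_mult_def sum_UNIV_Plus
      split: sum.split)

lemma block_row_times_transpose:
  "block_row X Y ** transpose (block_row U V) = X ** transpose U + Y ** transpose V"
  by (simp add: vec_eq_iff block_row_def matrix_matrix_mult_def transpose_def sum_UNIV_Plus)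

lemma H_map_G_mat:
  fixes A S P :: "real ^ 'n ^ 'n" and B :: "real ^ 'm ^ 'n" and K :: "real ^ 'n ^ 'm"
  shows "H_map (G_mat A B S R P) K =
     transpose (A - B ** K) ** P ** (A - B ** K) - P + S + transpose K ** R ** K"
proof -
  have minus_l: "(- M) ** N = - (M ** N)" for M :: "real ^ 'q ^ 'p" and N :: "real ^ 'r ^ 'q"
    by (simp add: vec_eq_iff matrix_matrix_mult_def sum_negf)
  have minus_r: "M ** (- N) = - (M ** N)" for M :: "real ^ 'q ^ 'p" and N :: "real ^ 'r ^ 'q"
    by (simp add: vec_eq_iff matrix_matrix_mult_def sum_negf)
  have diff_l: "(M - M') ** N = M ** N - M' ** N"
    for M M' :: "real ^ 'q ^ 'p" and N :: "real ^ 'r ^ 'q"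
    by (simp add: vec_eq_iff matrix_matrix_mult_def sum_subtractf algebra_simps)
  have diff_r: "M ** (N - N') = M ** N - M ** N'"
    for M :: "real ^ 'q ^ 'p" and N N' :: "real ^ 'r ^ 'q"
    by (simp add: vec_eq_iff matrix_matrix_mult_def sum_subtractf algebra_simps)
  have add_l: "(M + M') ** N = M ** N + M' ** N"
    for M M' :: "real ^ 'q ^ 'p" and N :: "real ^ 'r ^ 'q"
    by (simp add: vec_eq_iff matrix_matrix_mult_def sum.distrib algebra_simps)
  have add_r: "M ** (N + N') = M ** N + M ** N'"
    for M :: "real ^ 'q ^ 'p" and N N' :: "real ^ 'r ^ 'q"
    by (simp add: vec_eq_iff matrix_matrix_mult_def sum.distrib algebra_simps)
  have tr: "transpose (A - B ** K) = transpose A - transpose K ** transpose B"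
    by (simp add: matrix_transpose_mul[symmetric]) (simp add: transpose_def vec_eq_iff)
  have tr': "transpose (- transpose K) = - K"
    by (simp add: transpose_def vec_eq_iff)
  show ?thesis
    unfolding H_map_def G_mat_def block_row_times_block_mat block_row_times_transpose tr tr'
    by (simp add: minus_l minus_r diff_l diff_r add_l add_r matrix_mul_assoc)
qed

text \<open>Extended-real valued, so that an unbounded sequence has norm \<open>\<infinity>\<close>.\<close>

definition sup_norm :: "(nat \<Rightarrow> 'a::real_normed_vector) \<Rightarrow> ereal" where
  "sup_norm X = (SUP i\<in>{1..}. ereal (norm (X i)))"

end

theory Submission
  imports Defs "HOL-Computational_Algebra.Fundamental_Theorem_Algebra"
begin

text \<open>
  Compare symmetric matrices by their quadratic forms. The proof measures the error of an iterate
  relative to $P^*$: given $P^* \le \tilde P_i \le (1 + c_i) P^*$, which $c_{i+1}$ is valid for the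
  next iterate?

  Let $T(P)$ be the value-iteration map, i.e. the minimum over all gains of the one-step cost with
  terminal cost $P$. Exact policy iteration satisfies $\tilde P_{i+1} \le T(\tilde P_i)$. Using
  the optimal gain $K^*$ in place of the minimizer gives
  $T(P) - P^* \le (A - BK^*)^T (P - P^*) (A - BK^*)$, and since $S$ is positive definite there is
  $\rho < 1$ with $(A - BK^*)^T P^* (A - BK^*) \le \rho P^*$. So the relative error contracts by
  the factor $\rho$, no matter how large it is.

  A disturbance changes the gain that minimizes the one-step cost by some $E$. Completing the
  square (\<open>bellman_complete_square\<close>), this costs exactly $E^T (R + B^T P B) E$, which is at most
  $\eta S$ for a small disturbance, again since $S$ is positive definite. Then the old cost is still
  a Lyapunov function for the new gain, and $(1 - \eta) \tilde P_{i+1} \le T(\tilde P_i)$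
  (\<open>inexact_improvement\<close>). Altogether $c_{i+1} = \rho c_i + L \Vert \Delta G_i \Vert$ is valid as
  long as $c_i \le C$ (\<open>inexact_step\<close>), where $C$ is determined by the initial gain. Small
  disturbances never let $c_i$ exceed $C$, and all claims follow from this scalar recursion.

  The facts on Stein and Riccati equations used here rest on one comparison principle
  (\<open>nonneg_if_nonincreasing_along_stable\<close>): a continuous function that vanishes at 0 and does not
  increase along a stable linear map is nonnegative. It needs that the powers of a matrix of spectral
  radius below 1 tend to zero, which is proved by splitting off eigenvalue factors of an annihilating
  polynomial (\<open>eigenvalue_induct\<close>). The matrix $P^*$ exists as the limit of value iteration
  (\<open>fixpoint_exists\<close>) and is unique as the least cost of a stabilizing gain
  (\<open>fixpoint_unique\<close>).
\<close>

section \<open>Perturbed scalar contractions\<close>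

lemma linear_recursion_bound:
  fixes a :: "nat \<Rightarrow> real"
  assumes "0 \<le> \<rho>" "\<And>k. N \<le> k \<Longrightarrow> a (Suc k) \<le> \<rho> * a k + (1 - \<rho>) * b"
    and "0 \<le> b"
  shows "a (N + j) \<le> \<rho> ^ j * a N + b"
proof (induction j)
  case 0
  then show ?case using assms by simp
next
  case (Suc j)
  have "a (N + Suc j) \<le> \<rho> * a (N + j) + (1 - \<rho>) * b" using assms(2)[of "N + j"] by simp
  also have "\<dots> \<le> \<rho> * (\<rho> ^ j * a N + b) + (1 - \<rho>) * b"
    using mult_left_mono[OF Suc assms(1)] by simp
  finally show ?case by (simp add: algebra_simps)
qed

text \<open>
  Used twice: for the norms of $T^k x$ when an eigenvalue factor is split off, and for the
  relative error of the policy iteration under vanishing disturbances.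
\<close>

lemma perturbed_contraction_tendsto_0:
  fixes a d :: "nat \<Rightarrow> real"
  assumes "0 \<le> \<rho>" "\<rho> < 1" "\<And>k. 0 \<le> a k" "\<And>k. a (Suc k) \<le> \<rho> * a k + d k"
    and "d \<longlonglongrightarrow> 0"
  shows "a \<longlonglongrightarrow> 0"
proof (rule LIMSEQ_I)
  fix e :: real assume "0 < e"
  then have "0 < (1 - \<rho>) * (e / 2)" using assms by simp
  then obtain N where N: "\<And>k. N \<le> k \<Longrightarrow> norm (d k - 0) < (1 - \<rho>) * (e / 2)"
    using LIMSEQ_D[OF assms(5)] by blast
  have step: "a (Suc k) \<le> \<rho> * a k + (1 - \<rho>) * (e / 2)" if "N \<le> k" for k
    using assms(4)[of k] N[OF that] by simp
  have bound: "a (N + j) \<le> \<rho> ^ j * a N + e / 2" for j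
    using linear_recursion_bound[where a = a and b = "e / 2", OF assms(1) step] \<open>0 < e\<close> by simp
  have "(\<lambda>j. \<rho> ^ j * a N) \<longlonglongrightarrow> 0 * a N"
    by (intro tendsto_mult_right LIMSEQ_realpow_zero assms)
  then have "\<forall>\<^sub>F j in sequentially. \<rho> ^ j * a N < e / 2"
    using \<open>0 < e\<close> by (intro order_tendstoD(2)) auto
  then obtain J where J: "\<And>j. J \<le> j \<Longrightarrow> \<rho> ^ j * a N < e / 2"
    by (auto simp: eventually_sequentially)
  have "norm (a k - 0) < e" if "N + J \<le> k" for k
    using bound[of "k - N"] J[of "k - N"] that assms(3)[of k] by (simp add: le_diff_conv2)
  then show "\<exists>no. \<forall>k\<ge>no. norm (a k - 0) < e" by blast
qed

section \<open>Eigenvalues and powers of a matrix\<close>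

text \<open>
  The vector $p(T)x$, evaluated by Horner's scheme. Matrix powers are avoided because the power
  operation on the type of square matrices acts componentwise.
\<close>

definition poly_op :: "complex ^ 'n ^ 'n \<Rightarrow> complex poly \<Rightarrow> complex ^ 'n \<Rightarrow> complex ^ 'n" where
  "poly_op T p x = fold_coeffs (\<lambda>a y. a *s x + T *v y) p 0"

lemma poly_op_0 [simp]: "poly_op T 0 x = 0"
  by (simp add: poly_op_def)

lemma poly_op_pCons [simp]: "poly_op T (pCons a p) x = a *s x + T *v poly_op T p x"
  by (cases "p = 0 \<and> a = 0") (auto simp: poly_op_def)

lemma poly_op_add: "poly_op T (p + q) x = poly_op T p x + poly_op T q x"
  by (induction p q rule: poly_induct2)
    (simp_all add: vector_sadd_rdistrib matrix_vector_right_distrib)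

lemma poly_op_sum: "poly_op T (sum f I) x = (\<Sum>i\<in>I. poly_op T (f i) x)"
  by (induction I rule: infinite_finite_induct) (simp_all add: poly_op_add)

lemma poly_op_smult: "poly_op T (smult c p) x = c *s poly_op T p x"
  by (induction p) (simp_all add: vector_add_ldistrib vector_smult_assoc vector_scalar_commute)

lemma poly_op_monom: "poly_op T (monom c k) x = c *s ((*v) T ^^ k) x"
  by (induction k) (simp_all add: monom_0 monom_Suc vector_scalar_commute)

lemma poly_op_linear_factor:
  "poly_op T ([:- l, 1:] * p) x = T *v poly_op T p x - l *s poly_op T p x"
proof -
  have "[:- l, 1:] * p = smult (- l) p + pCons 0 p" by simp
  then show ?thesis by (simp only: poly_op_add poly_op_smult) simp
qed

lemma poly_op_commute:
  "poly_op T p (T *v x - l *s x) = T *v poly_op T p x - l *s poly_op T p x"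
proof (induction p)
  case (pCons a p)
  show ?case
    unfolding poly_op_pCons pCons(2)
    by (simp add: matrix_vector_mult_diff_distrib vector_scalar_commute vector_ssub_ldistrib
        vector_add_ldistrib vector_smult_assoc matrix_vector_right_distrib mult.commute[of a])
qed simp

lemma poly_op_eigenvector:
  assumes "T *v v = z *s v"
  shows "poly_op T p v = poly p z *s v"
  by (induction p) (simp_all add: vector_sadd_rdistrib vector_scalar_commute assms
      vector_smult_assoc mult.commute)

lemma linear_relation_of_long_family:
  fixes f :: "nat \<Rightarrow> 'a :: euclidean_space"
  obtains c where "(\<Sum>k\<le>DIM('a). c k *\<^sub>R f k) = 0" "\<exists>k\<le>DIM('a). c k \<noteq> 0"
proof (cases "inj_on f {..DIM('a)}")
  case True
  then have "card (f ` {..DIM('a)}) = Suc DIM('a)" by (simp add: card_image)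
  then have "dependent (f ` {..DIM('a)})" by (intro dependent_biggerset) auto
  then obtain u where u: "(\<Sum>v\<in>f ` {..DIM('a)}. u v *\<^sub>R v) = 0"
    "\<exists>v\<in>f ` {..DIM('a)}. u v \<noteq> 0"
    using dependent_finite[of "f ` {..DIM('a)}"] by auto
  show ?thesis
    using u by (intro that[of "u \<circ> f"]) (auto simp: sum.reindex[OF True])
next
  case False
  then obtain i j where ij: "i \<le> DIM('a)" "j \<le> DIM('a)" "i \<noteq> j" "f i = f j"
    by (auto simp: inj_on_def)
  let ?c = "\<lambda>k. (if k = i then 1 else 0) - (if k = j then 1 else 0) :: real"
  have "?c k *\<^sub>R f k = (if k = i then f k else 0) - (if k = j then f k else 0)" for k by simp
  then have "(\<Sum>k\<le>DIM('a). ?c k *\<^sub>R f k) =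
      (\<Sum>k\<le>DIM('a). (if k = i then f k else 0) - (if k = j then f k else 0))" by metis
  also have "\<dots> = 0" using ij by (simp add: sum_subtractf sum.delta)
  finally show ?thesis using ij by (intro that[of ?c]) auto
qed

text \<open>
  The powers of \<open>T\<close> live in a finite-dimensional real space, hence satisfy a linear relation
  with real coefficients. These are the coefficients of the polynomial.
\<close>

lemma annihilating_poly:
  fixes T :: "complex ^ 'n ^ 'n"
  obtains p where "p \<noteq> 0" "\<And>x. poly_op T p x = 0"
proof -
  let ?N = "DIM(complex ^ 'n ^ 'n)"
  let ?f = "\<lambda>k. ((**) T ^^ k) (mat 1)"
  obtain c where c: "(\<Sum>k\<le>?N. c k *\<^sub>R ?f k) = 0" "\<exists>k\<le>?N. c k \<noteq> 0"
    by (rule linear_relation_of_long_family)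
  have f: "?f k *v x = ((*v) T ^^ k) x" for k x
    by (induction k) (simp_all add: matrix_vector_mul_assoc[symmetric])
  let ?p = "\<Sum>k\<le>?N. monom (complex_of_real (c k)) k"
  have coeff: "coeff ?p k = complex_of_real (c k)" if "k \<le> ?N" for k
    using that by (simp add: coeff_sum)
  have scale: "complex_of_real r *s v = r *\<^sub>R v" for r and v :: "complex ^ 'n"
    unfolding vec_eq_iff vector_scaleR_component vector_smult_component
    by (simp add: scaleR_conv_of_real)
  have sum_v: "(\<Sum>k\<in>I. M k) *v x = (\<Sum>k\<in>I. M k *v x)"
    for I :: "nat set" and M :: "nat \<Rightarrow> complex ^ 'n ^ 'n" and x
    by (induction I rule: infinite_finite_induct) (simp_all add: matrix_vector_mult_add_rdistrib)
  have scale_v: "(r *\<^sub>R M) *v x = r *\<^sub>R (M *v x)" for r and M :: "complex ^ 'n ^ 'n" and x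
    by (simp add: vec_eq_iff matrix_vector_mult_def scaleR_sum_right)
  have "poly_op T ?p x = (\<Sum>k\<le>?N. c k *\<^sub>R ?f k) *v x" for x
    by (simp add: poly_op_sum poly_op_monom scale sum_v f scale_v)
  with c have "poly_op T ?p x = 0" for x by simp
  moreover have "?p \<noteq> 0" using c(2) coeff by (metis coeff_0 of_real_eq_0_iff)
  ultimately show ?thesis using that by blast
qed

text \<open>
  A substitute for triangularization. Some nonzero polynomial $p$ kills $x$; split off a linear
  factor, $p = (z - l) q$, and let $w = q(T) x$, so that $(T - l) w = 0$. Either $w = 0$, and
  $q$ already kills $x$, or $l$ is an eigenvalue with eigenvector $w$, and $q$ kills $(T - l)x$,
  as polynomials in $T$ commute. So, by induction on the degree, only factors that belong to
  genuine eigenvalues ever have to be passed.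
\<close>

lemma eigenvalue_induct:
  fixes T :: "complex ^ 'n ^ 'n"
  assumes zero: "Z 0"
    and step: "\<And>l x v. v \<noteq> 0 \<Longrightarrow> T *v v = l *s v \<Longrightarrow> Z (T *v x - l *s x) \<Longrightarrow> Z x"
  shows "Z x"
proof -
  obtain p where "p \<noteq> 0" "poly_op T p x = 0" using annihilating_poly[of T] by metis
  then show ?thesis
  proof (induction "degree p" arbitrary: p x)
    case 0
    then obtain a where "p = [:a:]" by (metis degree_eq_zeroE)
    with 0 show ?case using zero by simp
  next
    case (Suc n)
    then have "\<not> constant (poly p)" by (simp add: constant_degree)
    then obtain l where "poly p l = 0" using fundamental_theorem_of_algebra by blast
    then obtain q where q: "p = [:- l, 1:] * q" by (metis dvdE poly_eq_0_iff_dvd)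
    with Suc.prems have "q \<noteq> 0" by auto
    then have "degree p = Suc (degree q)" unfolding q by (subst degree_mult_eq) auto
    with Suc.hyps(2) have deg: "n = degree q" by simp
    have kernel: "T *v poly_op T q x = l *s poly_op T q x"
      using Suc.prems(2) unfolding q poly_op_linear_factor by simp
    show ?case
    proof (cases "poly_op T q x = 0")
      case True
      then show ?thesis using Suc.hyps(1)[OF deg \<open>q \<noteq> 0\<close>] by blast
    next
      case False
      have "poly_op T q (T *v x - l *s x) = 0" unfolding poly_op_commute kernel by simp
      then have "Z (T *v x - l *s x)" using Suc.hyps(1)[OF deg \<open>q \<noteq> 0\<close>] by blast
      then show ?thesis using step[OF False kernel] by blast
    qed
  qed
qed

text \<open>
  Finiteness and nonemptiness make the maximum in the definition of the spectral radius
  meaningful.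
\<close>

lemma finite_complex_spectrum: "finite (complex_spectrum M)"
proof -
  let ?T = "(\<chi> i j. complex_of_real (M $ i $ j))"
  obtain p where p: "p \<noteq> 0" "\<And>x. poly_op ?T p x = 0" using annihilating_poly by blast
  have "complex_spectrum M \<subseteq> {z. poly p z = 0}"
  proof
    fix z assume "z \<in> complex_spectrum M"
    then obtain v where "v \<noteq> 0" "?T *v v = z *s v" by (auto simp: complex_spectrum_def)
    with p(2)[of v] poly_op_eigenvector[of ?T v z p] show "z \<in> {z. poly p z = 0}" by simp
  qed
  then show ?thesis using poly_roots_finite[OF p(1)] finite_subset by blast
qed

text \<open>
  Without eigenvalues, the induction principle would put every vector equal to zero.
\<close>

lemma complex_spectrum_nonempty:
  fixes M :: "real ^ 'n ^ 'n"
  shows "complex_spectrum M \<noteq> {}"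
proof
  assume empty: "complex_spectrum M = {}"
  have "x = 0" for x :: "complex ^ 'n"
    by (rule eigenvalue_induct[of "\<lambda>x. x = 0" "\<chi> i j. complex_of_real (M $ i $ j)"])
      (use empty in \<open>auto simp: complex_spectrum_def\<close>)
  from this[of "vec 1"] show False by (simp add: vec_eq_iff)
qed

lemma stable_iff: "stable M \<longleftrightarrow> (\<forall>z\<in>complex_spectrum M. cmod z < 1)"
  using finite_complex_spectrum[of M] complex_spectrum_nonempty[of M]
  by (simp add: stable_def spec_radius_def)

text \<open>
  By the induction principle it suffices to pass from $y = (T - l)x$ to $x$ for an eigenvalue
  $l$. There $T^{k+1} x = l T^k x + T^k y$ with $|l| < 1$ and $T^k y \to 0$, so the norms
  $|T^k x|$ form a perturbed contraction.
\<close>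

lemma stable_powers_tendsto_0:
  fixes M :: "real ^ 'n ^ 'n"
  assumes "stable M"
  shows "(\<lambda>k. ((*v) M ^^ k) x) \<longlonglongrightarrow> 0"
proof -
  let ?T = "\<chi> i j. complex_of_real (M $ i $ j)"
  define c where "c y = (\<chi> i. complex_of_real (y $ i))" for y :: "real ^ 'n"
  have c_mult: "?T *v c y = c (M *v y)" for y
    by (simp add: c_def vec_eq_iff matrix_vector_mult_def)
  have "(\<lambda>k. ((*v) ?T ^^ k) z) \<longlonglongrightarrow> 0" for z
  proof (rule eigenvalue_induct[of "\<lambda>z. (\<lambda>k. ((*v) ?T ^^ k) z) \<longlonglongrightarrow> 0" ?T])
    show "(\<lambda>k. ((*v) ?T ^^ k) 0) \<longlonglongrightarrow> 0"
    proof -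
      have "((*v) ?T ^^ k) 0 = 0" for k by (induction k) simp_all
      then show ?thesis by simp
    qed
  next
    fix l y v
    assume v: "v \<noteq> 0" "?T *v v = l *s v"
      and lim: "(\<lambda>k. ((*v) ?T ^^ k) (?T *v y - l *s y)) \<longlonglongrightarrow> 0"
    from v have "l \<in> complex_spectrum M" by (auto simp: complex_spectrum_def)
    with assms have l: "cmod l < 1" by (simp add: stable_iff)
    have shift: "((*v) ?T ^^ k) (?T *v y - l *s y) = ((*v) ?T ^^ Suc k) y - l *s ((*v) ?T ^^ k) y"
      for k
      by (induction k) (simp_all add: matrix_vector_mult_diff_distrib vector_scalar_commute)
    have norm_scale: "norm (l *s w) = cmod l * norm w" for w :: "complex ^ 'n"
      by (simp add: norm_vec_def L2_set_def norm_mult power_mult_distrib real_sqrt_mult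
          sum_distrib_left[symmetric])
    have "(\<lambda>k. norm (((*v) ?T ^^ k) y)) \<longlonglongrightarrow> 0"
    proof (rule perturbed_contraction_tendsto_0[OF _ l])
      show "norm (((*v) ?T ^^ Suc k) y) \<le>
          cmod l * norm (((*v) ?T ^^ k) y) + norm (((*v) ?T ^^ k) (?T *v y - l *s y))" for k
        using norm_triangle_ineq[of "l *s ((*v) ?T ^^ k) y" "((*v) ?T ^^ k) (?T *v y - l *s y)"]
        by (simp add: shift norm_scale)
    qed (use lim in \<open>auto intro: tendsto_norm_zero\<close>)
    then show "(\<lambda>k. ((*v) ?T ^^ k) y) \<longlonglongrightarrow> 0" by (rule tendsto_norm_zero_cancel)
  qed
  then have lim: "(\<lambda>k. ((*v) ?T ^^ k) (c x)) \<longlonglongrightarrow> 0" .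
  have pow: "((*v) ?T ^^ k) (c x) = c (((*v) M ^^ k) x)" for k
    by (induction k) (simp_all add: c_mult)
  have "(\<lambda>k. (((*v) M ^^ k) x) $ i) \<longlonglongrightarrow> 0" for i
    using tendsto_Re[OF tendsto_vec_nth[OF lim[unfolded pow], of i]] by (simp add: c_def)
  then show ?thesis by (intro vec_tendstoI) simp
qed

section \<open>Quadratic forms\<close>

definition quad :: "real ^ 'n ^ 'n \<Rightarrow> real ^ 'n \<Rightarrow> real" where
  "quad X x = x \<bullet> (X *v x)"

text \<open>
  For an eigenvector $x + iy$ to the eigenvalue $z$, the map \<open>M\<close> multiplies the value
  \<open>quad P x + quad P y\<close> by $|z|^2$; as this value decreases, $|z| < 1$.
\<close>

lemma stable_if_lyapunov_decrease:
  fixes M P :: "real ^ 'n ^ 'n"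
  assumes nonneg: "\<And>x. 0 \<le> quad P x"
    and decrease: "\<And>x. x \<noteq> 0 \<Longrightarrow> quad P (M *v x) < quad P x"
  shows "stable M"
  unfolding stable_iff
proof
  fix z assume "z \<in> complex_spectrum M"
  then obtain v where v: "v \<noteq> 0" "(\<chi> i j. complex_of_real (M $ i $ j)) *v v = z *s v"
    by (auto simp: complex_spectrum_def)
  define x where "x = (\<chi> i. Re (v $ i))"
  define y where "y = (\<chi> i. Im (v $ i))"
  have Mx: "M *v x = Re z *\<^sub>R x - Im z *\<^sub>R y"
    using v(2) by (simp add: x_def y_def vec_eq_iff matrix_vector_mult_def complex_eq_iff)
  have My: "M *v y = Im z *\<^sub>R x + Re z *\<^sub>R y"
    using v(2) by (simp add: x_def y_def vec_eq_iff matrix_vector_mult_def complex_eq_iff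
        add.commute)
  have xy: "x \<noteq> 0 \<or> y \<noteq> 0"
    using v(1) by (auto simp: x_def y_def vec_eq_iff complex_eq_iff)
  have "quad P (M *v x) + quad P (M *v y) = (cmod z)\<^sup>2 * (quad P x + quad P y)"
    unfolding Mx My quad_def cmod_power2
    by (simp add: inner_simps matrix_vector_right_distrib matrix_vector_mult_diff_distrib
        matrix_vector_mult_scaleR power2_eq_square algebra_simps)
  moreover have "quad P (M *v x) + quad P (M *v y) < quad P x + quad P y"
    using xy decrease[of x] decrease[of y] by (cases "x = 0"; cases "y = 0") auto
  ultimately have "(cmod z)\<^sup>2 * (quad P x + quad P y) < 1 * (quad P x + quad P y)" by simp
  moreover have "0 \<le> quad P x + quad P y" using nonneg[of x] nonneg[of y] by simp
  ultimately have "(cmod z)\<^sup>2 < 1" by (meson mult_right_mono not_le)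
  then show "cmod z < 1" by (simp add: abs_square_less_1)
qed

lemma matrix_mult_diff_left: "(X - Y) ** Z = X ** Z - Y ** (Z :: real ^ 'r ^ 'p)"
  by (simp add: vec_eq_iff matrix_matrix_mult_def sum_subtractf algebra_simps)

lemma matrix_mult_diff_right: "Z ** (X - Y) = Z ** X - Z ** (Y :: real ^ 'r ^ 'p)"
  by (simp add: vec_eq_iff matrix_matrix_mult_def sum_subtractf algebra_simps)

lemma matrix_mult_add_left: "(X + Y) ** Z = X ** Z + Y ** (Z :: real ^ 'r ^ 'p)"
  by (simp add: vec_eq_iff matrix_matrix_mult_def sum.distrib algebra_simps)

lemma matrix_inv_mult_cancel:
  fixes X :: "real ^ 'n ^ 'n"
  assumes "invertible X"
  shows "X ** (matrix_inv X ** Y) = Y"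
proof -
  have "X ** matrix_inv X = mat 1"
    using assms unfolding invertible_def matrix_inv_def by (rule someI2_ex) simp
  then show ?thesis by (simp add: matrix_mul_assoc)
qed

lemma inner_transpose_mult: "x \<bullet> (transpose M *v y) = (M *v x) \<bullet> (y :: real ^ 'p)"
  for M :: "real ^ 'q ^ 'p"
  by (metis dot_lmul_matrix inner_commute transpose_matrix_vector)

lemma sym_mat_inner: "sym_mat X \<Longrightarrow> x \<bullet> (X *v y) = (X *v x) \<bullet> y"
  by (metis inner_transpose_mult sym_mat_def)

lemma transpose_add: "transpose (X + Y) = transpose X + transpose (Y :: real ^ 'p ^ 'q)"
  by (simp add: transpose_def vec_eq_iff)

lemma transpose_diff: "transpose (X - Y) = transpose X - transpose (Y :: real ^ 'p ^ 'q)"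
  by (simp add: transpose_def vec_eq_iff)

lemma sym_mat_add: "sym_mat X \<Longrightarrow> sym_mat Y \<Longrightarrow> sym_mat (X + Y)"
  by (simp add: sym_mat_def transpose_add)

lemma sym_mat_congruence: "sym_mat P \<Longrightarrow> sym_mat (transpose M ** P ** M)"
  by (simp add: sym_mat_def matrix_transpose_mul matrix_mul_assoc)

lemma quad_add [simp]: "quad (X + Y) x = quad X x + quad Y x"
  by (simp add: quad_def matrix_vector_mult_add_rdistrib inner_right_distrib)

lemma quad_diff [simp]: "quad (X - Y) x = quad X x - quad Y x"
  by (simp add: quad_def matrix_vector_mult_diff_rdistrib inner_diff_right)

lemma quad_zero [simp]: "quad X 0 = 0"
  by (simp add: quad_def)

lemma quad_congruence: "quad (transpose M ** P ** M) x = quad P (M *v x)"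
  by (simp add: quad_def matrix_vector_mul_assoc[symmetric] inner_transpose_mult
        del: transpose_matrix_vector)

lemma quad_vector_add:
  assumes "sym_mat X"
  shows "quad X (x + y) = quad X x + 2 * (x \<bullet> (X *v y)) + quad X y"
proof -
  have "y \<bullet> (X *v x) = x \<bullet> (X *v y)" using sym_mat_inner[OF assms] by (simp add: inner_commute)
  then show ?thesis by (simp add: quad_def inner_simps matrix_vector_right_distrib)
qed

lemma quad_vector_diff:
  assumes "sym_mat X"
  shows "quad X (x - y) = quad X x - 2 * (x \<bullet> (X *v y)) + quad X y"
proof -
  have "y \<bullet> (X *v x) = x \<bullet> (X *v y)" using sym_mat_inner[OF assms] by (simp add: inner_commute)
  then show ?thesis by (simp add: quad_def inner_simps matrix_vector_mult_diff_distrib)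
qed

lemma polarization:
  assumes "sym_mat X"
  shows "x \<bullet> (X *v y) = (quad X (x + y) - quad X x - quad X y) / 2"
  using quad_vector_add[OF assms, of x y] by simp

lemma sym_mat_eqI:
  assumes "sym_mat X" "sym_mat Y" "\<And>x. quad X x = quad Y x"
  shows "X = Y"
proof -
  have "x \<bullet> (X *v y) = x \<bullet> (Y *v y)" for x y
    by (simp add: polarization[OF assms(1)] polarization[OF assms(2)] assms(3))
  then have "X *v y = Y *v y" for y by (metis vector_eq_ldot)
  then show ?thesis by (simp add: matrix_eq)
qed

lemma sym_mat_entry:
  assumes "sym_mat X"
  shows "X $ i $ j = (quad X (axis i 1 + axis j 1) - quad X (axis i 1) - quad X (axis j 1)) / 2"
  unfolding polarization[OF assms, symmetric]
  by (simp add: inner_axis' matrix_vector_mul_component inner_axis)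

lemma norm_matrix_vector_mult_le:
  fixes X :: "real ^ 'p ^ 'q"
  shows "norm (X *v x) \<le> norm X * norm x"
proof -
  have "(norm (X *v x))\<^sup>2 = (\<Sum>i\<in>UNIV. ((X $ i) \<bullet> x)\<^sup>2)"
    unfolding power2_norm_eq_inner inner_vec_def[of "X *v x"]
    by (simp add: matrix_vector_mul_component power2_eq_square)
  also have "\<dots> \<le> (\<Sum>i\<in>UNIV. (norm (X $ i))\<^sup>2 * (norm x)\<^sup>2)"
  proof (rule sum_mono)
    fix i
    have "\<bar>(X $ i) \<bullet> x\<bar> \<le> norm (X $ i) * norm x" by (rule Cauchy_Schwarz_ineq2)
    then show "((X $ i) \<bullet> x)\<^sup>2 \<le> (norm (X $ i))\<^sup>2 * (norm x)\<^sup>2"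
      by (metis abs_ge_zero power2_abs power_mono power_mult_distrib)
  qed
  also have "\<dots> = (norm X * norm x)\<^sup>2"
    by (simp add: sum_distrib_right[symmetric] power_mult_distrib power2_norm_eq_inner
        inner_vec_def[of X])
  finally show ?thesis by (rule power2_le_imp_le) simp
qed

lemma norm_square_columns:
  fixes X :: "real ^ 'p ^ 'q"
  shows "(norm X)\<^sup>2 = (\<Sum>j\<in>UNIV. (norm (column j X))\<^sup>2)"
  unfolding power2_norm_eq_inner inner_vec_def column_def
  by (simp, subst sum.swap, simp)

lemma column_matrix_mult: "column j (X ** Y) = X *v column j Y"
  by (simp add: column_def vec_eq_iff matrix_matrix_mult_def matrix_vector_mult_def)

lemma norm_matrix_mult_le:
  fixes X :: "real ^ 'p ^ 'q" and Y :: "real ^ 'r ^ 'p"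
  shows "norm (X ** Y) \<le> norm X * norm Y"
proof -
  have "(norm (X ** Y))\<^sup>2 \<le> (\<Sum>j\<in>UNIV. (norm X * norm (column j Y))\<^sup>2)"
    unfolding norm_square_columns[of "X ** Y"] column_matrix_mult
    by (intro sum_mono power_mono norm_matrix_vector_mult_le) simp
  also have "\<dots> = (norm X * norm Y)\<^sup>2"
    by (simp add: power_mult_distrib sum_distrib_left[symmetric] norm_square_columns[of Y])
  finally show ?thesis by (rule power2_le_imp_le) simp
qed

text \<open>
  The Frobenius norm is read off the columns, i.e. off the images of the basis vectors.
\<close>

lemma norm_le_columnwise:
  fixes X :: "real ^ 'p ^ 'q" and Y :: "real ^ 'p ^ 'r"
  assumes "\<And>x. norm (X *v x) \<le> norm (Y *v x)"
  shows "norm X \<le> norm Y"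
proof -
  have "column j X = X *v axis j 1" "column j Y = Y *v axis j 1" for j
    by (simp_all add: matrix_vector_mult_basis)
  then have "(norm X)\<^sup>2 \<le> (norm Y)\<^sup>2"
    unfolding norm_square_columns[of X] norm_square_columns[of Y]
    by (intro sum_mono power_mono) (simp_all add: assms)
  then show ?thesis by (rule power2_le_imp_le) simp
qed

lemma norm_transpose: "norm (transpose X) = norm (X :: real ^ 'p ^ 'q)"
proof -
  have "(norm (transpose X))\<^sup>2 = (norm X)\<^sup>2"
    by (simp add: norm_square_columns[of X] column_transpose[symmetric])
      (simp add: power2_norm_eq_inner inner_vec_def column_def transpose_def)
  then show ?thesis by simp
qed

lemma quad_le_norm: "quad X x \<le> norm X * (norm x)\<^sup>2"
proof -
  have "quad X x \<le> norm x * norm (X *v x)" unfolding quad_def by (rule norm_cauchy_schwarz)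
  also have "\<dots> \<le> norm x * (norm X * norm x)"
    by (intro mult_left_mono norm_matrix_vector_mult_le) simp
  finally show ?thesis by (simp add: power2_eq_square mult_ac)
qed

text \<open>
  Order bounds on quadratic forms become norm bounds by polarizing to the matrix entries. The
  constant is far from optimal, but only its existence matters.
\<close>

lemma norm_le_if_quad_bounded:
  fixes X :: "real ^ 'n ^ 'n"
  assumes "sym_mat X" and nonneg: "\<And>x. 0 \<le> quad X x" and upper: "\<And>x. quad X x \<le> b * (norm x)\<^sup>2"
  shows "norm X \<le> 2 * real CARD('n) * real CARD('n) * b"
proof -
  have b: "0 \<le> b" using nonneg[of "axis undefined 1"] upper[of "axis undefined 1"] by simp
  have "\<bar>X $ i $ j\<bar> \<le> 2 * b" for i j
  proof -
    have "norm (axis i 1 + axis j 1 :: real ^ 'n) \<le> 1 + 1"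
      using norm_triangle_ineq[of "axis i (1::real)" "axis j 1"] by simp
    then have "(norm (axis i 1 + axis j 1 :: real ^ 'n))\<^sup>2 \<le> 2\<^sup>2" by (intro power_mono) auto
    then have "b * (norm (axis i 1 + axis j 1 :: real ^ 'n))\<^sup>2 \<le> b * 4"
      using b by (intro mult_left_mono) auto
    with upper[of "axis i 1 + axis j 1"] have "quad X (axis i 1 + axis j 1) \<le> b * 4" by linarith
    with nonneg[of "axis i 1 + axis j 1"] nonneg[of "axis i 1"] nonneg[of "axis j 1"]
      upper[of "axis i 1"] upper[of "axis j 1"] b
    show ?thesis unfolding sym_mat_entry[OF assms(1), of i j] by simp
  qed
  then have entry: "norm (X $ i) \<le> (\<Sum>j\<in>(UNIV :: 'n set). 2 * b)" for i
    by (intro order_trans[OF norm_le_l1_cart] sum_mono) auto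
  have "norm X \<le> (\<Sum>i\<in>UNIV. norm (X $ i))" unfolding norm_vec_def by (rule L2_set_le_sum) simp
  also have "\<dots> \<le> (\<Sum>i\<in>(UNIV :: 'n set). \<Sum>j\<in>(UNIV :: 'n set). 2 * b)"
    using entry by (intro sum_mono)
  finally show ?thesis by simp
qed

lemma tendsto_quad:
  assumes "X \<longlonglongrightarrow> L"
  shows "(\<lambda>k. quad (X k) x) \<longlonglongrightarrow> quad L x"
  unfolding quad_def matrix_vector_mult_def inner_vec_def
  by (simp, intro tendsto_intros tendsto_vec_nth assms)

lemma isCont_quad: "isCont (quad X) x"
  unfolding quad_def by (intro continuous_intros linear_continuous_at matrix_vector_mul_bounded_linear)

lemma pos_def_iff_quad: "pos_def X \<longleftrightarrow> sym_mat X \<and> (\<forall>x. x \<noteq> 0 \<longrightarrow> 0 < quad X x)"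
  by (simp add: pos_def_def quad_def)

lemma pos_def_quad_nonneg: "pos_def X \<Longrightarrow> 0 \<le> quad X x"
  by (cases "x = 0") (auto simp: pos_def_iff_quad intro: less_imp_le)

lemma pos_def_lower_bound:
  fixes X :: "real ^ 'n ^ 'n"
  assumes "pos_def X"
  obtains s where "0 < s" "\<And>x. s * (norm x)\<^sup>2 \<le> quad X x"
proof -
  have "continuous_on (sphere 0 1) (quad X)"
    by (intro continuous_at_imp_continuous_on ballI isCont_quad)
  moreover have "compact (sphere 0 1 :: (real ^ 'n) set)" "sphere 0 1 \<noteq> ({} :: (real ^ 'n) set)"
    by simp_all
  ultimately obtain y where y: "y \<in> sphere 0 1" "\<And>x. x \<in> sphere 0 1 \<Longrightarrow> quad X y \<le> quad X x"
    using continuous_attains_inf by meson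
  have "quad X y * (norm x)\<^sup>2 \<le> quad X x" for x
  proof (cases "x = 0")
    case False
    then have "quad X y \<le> quad X (x /\<^sub>R norm x)" by (intro y(2)) simp
    also have "\<dots> = quad X x / (norm x)\<^sup>2"
      by (simp add: quad_def matrix_vector_mult_scaleR power2_eq_square divide_simps)
    finally show ?thesis using False by (simp add: field_simps)
  qed simp
  moreover have "0 < quad X y" using y(1) assms by (cases "y = 0") (auto simp: pos_def_iff_quad)
  ultimately show ?thesis using that by blast
qed

lemma invertible_if_quad_pos:
  fixes X :: "real ^ 'n ^ 'n"
  assumes "\<And>x. x \<noteq> 0 \<Longrightarrow> 0 < quad X x"
  shows "invertible X"
proof -
  have "x = 0" if "X *v x = 0" for x
    using assms[of x] that by (auto simp: quad_def)
  then show ?thesis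
    unfolding invertible_left_inverse matrix_left_invertible_ker by blast
qed

lemma norm_le_norm_mult_if_quad_ge:
  fixes X :: "real ^ 'n ^ 'n" and Y :: "real ^ 'p ^ 'n"
  assumes "0 < r" "\<And>x. r * (norm x)\<^sup>2 \<le> quad X x"
  shows "r * norm Y \<le> norm (X ** Y)"
proof -
  have vec: "r * norm x \<le> norm (X *v x)" for x
  proof (cases "x = 0")
    case False
    have "r * (norm x)\<^sup>2 \<le> norm x * norm (X *v x)"
      using assms(2)[of x] norm_cauchy_schwarz[of x "X *v x"] unfolding quad_def by linarith
    with False show ?thesis by (simp add: power2_eq_square)
  qed simp
  have "norm (r *\<^sub>R Y) \<le> norm (X ** Y)"
  proof (rule norm_le_columnwise)
    show "norm ((r *\<^sub>R Y) *v x) \<le> norm ((X ** Y) *v x)" for x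
      using vec[of "Y *v x"] assms(1)
      by (simp add: scaleR_matrix_vector_assoc[symmetric] matrix_vector_mul_assoc[symmetric])
  qed
  with assms(1) show ?thesis by simp
qed

text \<open>
  A coercive \<open>W\<close> stays coercive under a perturbation of at most half its coercivity constant. The
  error $E$ of the solution satisfies $(W + \Delta W) E = \Delta F - \Delta W X$, which is
  then estimated by coercivity.
\<close>

lemma perturbed_linear_solution:
  fixes W \<Delta>W :: "real ^ 'm ^ 'm" and X F \<Delta>F :: "real ^ 'n ^ 'm"
  assumes r: "0 < r" "\<And>u. r * (norm u)\<^sup>2 \<le> quad W u"
    and X: "W ** X = F"
    and \<delta>: "norm \<Delta>W \<le> \<delta>" "norm \<Delta>F \<le> \<delta>" "\<delta> \<le> r / 2"
  shows "invertible (W + \<Delta>W)"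
    and "norm (matrix_inv (W + \<Delta>W) ** (F + \<Delta>F) - X) \<le> 2 * \<delta> / r * (1 + norm X)"
proof -
  have lower: "(r / 2) * (norm u)\<^sup>2 \<le> quad (W + \<Delta>W) u" for u
  proof -
    have "- quad \<Delta>W u = quad (- \<Delta>W) u"
      using quad_diff[of 0 \<Delta>W u] by (simp add: quad_def)
    also have "\<dots> \<le> norm \<Delta>W * (norm u)\<^sup>2" using quad_le_norm[of "- \<Delta>W" u] by simp
    also have "\<dots> \<le> (r / 2) * (norm u)\<^sup>2" using \<delta> by (intro mult_right_mono) auto
    finally show ?thesis using r(2)[of u] by simp
  qed
  have "0 < quad (W + \<Delta>W) u" if "u \<noteq> 0" for u
    using lower[of u] that r(1) by (smt (verit) half_gt_zero mult_pos_pos zero_less_norm_iff zero_less_power)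
  then show inv: "invertible (W + \<Delta>W)" by (rule invertible_if_quad_pos)
  let ?E = "matrix_inv (W + \<Delta>W) ** (F + \<Delta>F) - X"
  have "(W + \<Delta>W) ** ?E = \<Delta>F - \<Delta>W ** X"
    unfolding matrix_mult_diff_right matrix_inv_mult_cancel[OF inv]
    by (simp add: matrix_mult_add_left X)
  then have "(r / 2) * norm ?E \<le> norm (\<Delta>F - \<Delta>W ** X)"
    using norm_le_norm_mult_if_quad_ge[OF _ lower, of ?E] r(1) by simp
  also have "\<dots> \<le> norm \<Delta>F + norm \<Delta>W * norm X"
    by (rule order_trans[OF norm_triangle_ineq4]) (simp add: norm_matrix_mult_le)
  also have "\<dots> \<le> \<delta> + \<delta> * norm X" using \<delta> by (intro add_mono mult_right_mono) auto
  finally show "norm ?E \<le> 2 * \<delta> / r * (1 + norm X)" using r(1) by (simp add: field_simps)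
qed

text \<open>
  Monotone convergence for symmetric matrices: the quadratic forms converge pointwise, and the
  entries are finite combinations of their values.
\<close>

lemma decreasing_quad_convergent:
  fixes X :: "nat \<Rightarrow> real ^ 'n ^ 'n"
  assumes sym: "\<And>k. sym_mat (X k)" and nonneg: "\<And>k x. 0 \<le> quad (X k) x"
    and decr: "\<And>k x. quad (X (Suc k)) x \<le> quad (X k) x"
  obtains L where "X \<longlonglongrightarrow> L" "sym_mat L" "\<And>k x. quad L x \<le> quad (X k) x"
proof -
  have "\<exists>l. (\<lambda>k. quad (X k) x) \<longlonglongrightarrow> l" for x
    by (rule decseq_convergent[of "\<lambda>k. quad (X k) x" 0]) (use nonneg decr in \<open>auto intro: decseq_SucI\<close>)
  then obtain l where l: "\<And>x. (\<lambda>k. quad (X k) x) \<longlonglongrightarrow> l x" by metis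
  define L where "L = (\<chi> i j. (l (axis i 1 + axis j 1) - l (axis i 1) - l (axis j 1)) / 2)"
  have "X \<longlonglongrightarrow> L"
    unfolding L_def
    by (intro vec_tendstoI) (simp add: sym_mat_entry[OF sym], intro tendsto_intros l, simp)
  moreover have "sym_mat L"
    by (simp add: sym_mat_def transpose_def L_def vec_eq_iff add.commute)
  moreover have "quad L x \<le> quad (X k) x" for k x
    by (rule decseq_ge[OF _ tendsto_quad[OF \<open>X \<longlonglongrightarrow> L\<close>]]) (auto intro: decseq_SucI decr)
  ultimately show ?thesis using that by blast
qed

lemma norm_block_uu_le: "norm (block_uu \<Delta>) \<le> norm \<Delta>"
  for \<Delta> :: "real ^ ('n::finite + 'm::finite) ^ ('n::finite + 'm::finite)"
proof -
  have "(\<Sum>i\<in>UNIV. \<Sum>j\<in>UNIV. (block_uu \<Delta> $ i $ j)\<^sup>2) \<le> (\<Sum>i\<in>UNIV. \<Sum>j\<in>UNIV. (\<Delta> $ i $ j)\<^sup>2)"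
    unfolding sum_UNIV_Plus by (simp add: block_uu_def sum.distrib sum_nonneg add_nonneg_nonneg)
  then show ?thesis by (simp add: norm_eq_Frobenius)
qed

lemma norm_block_ux_le: "norm (block_ux \<Delta>) \<le> norm \<Delta>"
  for \<Delta> :: "real ^ ('n::finite + 'm::finite) ^ ('n::finite + 'm::finite)"
proof -
  have "(\<Sum>i\<in>UNIV. \<Sum>j\<in>UNIV. (block_ux \<Delta> $ i $ j)\<^sup>2) \<le> (\<Sum>i\<in>UNIV. \<Sum>j\<in>UNIV. (\<Delta> $ i $ j)\<^sup>2)"
    unfolding sum_UNIV_Plus by (simp add: block_ux_def sum.distrib sum_nonneg add_nonneg_nonneg)
  then show ?thesis by (simp add: norm_eq_Frobenius)
qed

section \<open>Stein equations\<close>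

text \<open>
  The comparison principle behind all inequalities between policy costs: \<open>f x\<close> dominates
  the values of \<open>f\<close> along the orbit of \<open>x\<close>, which tends to zero. It replaces the
  representation of solutions of Stein equations by series.
\<close>

lemma nonneg_if_nonincreasing_along_stable:
  fixes f :: "real ^ 'n \<Rightarrow> real"
  assumes "stable M" "isCont f 0" "f 0 = 0" "\<And>x. f (M *v x) \<le> f x"
  shows "0 \<le> f x"
proof -
  have "f (((*v) M ^^ k) x) \<le> f x" for k
    by (induction k) (auto intro: order_trans assms(4))
  moreover have "(\<lambda>k. f (((*v) M ^^ k) x)) \<longlonglongrightarrow> f 0"
    using isCont_tendsto_compose[OF assms(2) stable_powers_tendsto_0[OF assms(1)]] .
  ultimately show ?thesis using LIMSEQ_le_const2 assms(3) by metis
qed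

lemma stein_unique:
  fixes M X :: "real ^ 'n ^ 'n"
  assumes "stable M" "transpose M ** X ** M = X"
  shows "X = 0"
proof -
  \<comment> \<open>The bilinear form of \<open>X\<close> is invariant along orbits, which tend to zero.\<close>
  have inv: "x \<bullet> (X *v y) = (M *v x) \<bullet> (X *v (M *v y))" for x y
    by (subst assms(2)[symmetric])
      (simp add: matrix_vector_mul_assoc[symmetric] inner_transpose_mult
        del: transpose_matrix_vector)
  have "x \<bullet> (X *v y) = 0" for x y
  proof -
    have const: "((*v) M ^^ k) x \<bullet> (X *v ((*v) M ^^ k) y) = x \<bullet> (X *v y)" for k
      by (induction k) (simp_all add: inv[symmetric])
    have "(\<lambda>k. ((*v) M ^^ k) x \<bullet> (X *v ((*v) M ^^ k) y)) \<longlonglongrightarrow> 0 \<bullet> (X *v 0)"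
      by (intro tendsto_inner stable_powers_tendsto_0 assms(1)
          bounded_linear.tendsto[OF matrix_vector_mul_bounded_linear])
    then have "(\<lambda>k. x \<bullet> (X *v y)) \<longlonglongrightarrow> 0" unfolding const by simp
    then show ?thesis by (simp add: LIMSEQ_const_iff)
  qed
  then have "X *v y = 0 *v y" for y by (metis inner_eq_zero_iff matrix_vector_mult_0)
  then show ?thesis unfolding matrix_eq by blast
qed

text \<open>
  Existence follows from uniqueness, because the equation is linear in finite dimension.
\<close>

lemma stein_solution_exists:
  fixes M Q :: "real ^ 'n ^ 'n"
  assumes "stable M"
  obtains X where "X = transpose M ** X ** M + Q"
proof -
  let ?f = "\<lambda>X. X - transpose M ** X ** M"
  have lin: "linear ?f"
    by (intro linearI)
      (simp_all add: vec_eq_iff matrix_matrix_mult_def sum.distrib sum_distrib_left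
        sum_distrib_right algebra_simps)
  have "inj ?f"
    unfolding linear_injective_0[OF lin] using stein_unique[OF assms] by auto
  then have "surj ?f" by (rule linear_inj_imp_surj[OF lin])
  then obtain X where X: "Q = ?f X" by (rule surjE)
  have "X = transpose M ** X ** M + Q" unfolding X by simp
  then show ?thesis by (rule that)
qed

section \<open>Policy costs and the Riccati equation\<close>

locale lqr =
  fixes A S :: "real ^ 'n ^ 'n" and B :: "real ^ 'm ^ 'n" and R :: "real ^ 'm ^ 'm"
  assumes S_pos: "pos_def S" and R_pos: "pos_def R"
begin

definition closed_loop :: "real ^ 'n ^ 'm \<Rightarrow> real ^ 'n ^ 'n" where
  "closed_loop K = A - B ** K"

definition input_weight :: "real ^ 'n ^ 'n \<Rightarrow> real ^ 'm ^ 'm" where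
  "input_weight P = R + transpose B ** P ** B"

definition gain :: "real ^ 'n ^ 'n \<Rightarrow> real ^ 'n ^ 'm" where
  "gain P = matrix_inv (input_weight P) ** (transpose B ** P ** A)"

text \<open>
  Cost of using the gain \<open>K\<close> for one step and then paying the terminal cost \<open>P\<close>. Its
  fixed points are the policy costs of \<open>K\<close>; with \<open>K = gain P\<close> it is the value-iteration
  map, whose fixed points solve the Riccati equation.
\<close>

definition bellman :: "real ^ 'n ^ 'm \<Rightarrow> real ^ 'n ^ 'n \<Rightarrow> real ^ 'n ^ 'n" where
  "bellman K P = transpose (closed_loop K) ** P ** closed_loop K + S + transpose K ** R ** K"

lemma S_sym: "sym_mat S" and R_sym: "sym_mat R"
  using S_pos R_pos by (simp_all add: pos_def_def)

lemma S_nonneg: "0 \<le> quad S x" and R_nonneg: "0 \<le> quad R u"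
  using S_pos R_pos by (simp_all add: pos_def_quad_nonneg)

lemma quad_bellman:
  "quad (bellman K P) x = quad P (closed_loop K *v x) + quad S x + quad R (K *v x)"
  by (simp add: bellman_def quad_congruence)

lemma sym_bellman: "sym_mat P \<Longrightarrow> sym_mat (bellman K P)"
  unfolding bellman_def by (intro sym_mat_add sym_mat_congruence S_sym R_sym)

lemma quad_input_weight: "quad (input_weight P) u = quad R u + quad P (B *v u)"
  by (simp add: input_weight_def quad_congruence)

lemma invertible_input_weight:
  assumes "\<And>x. 0 \<le> quad P x"
  shows "invertible (input_weight P)"
proof (rule invertible_if_quad_pos)
  show "0 < quad (input_weight P) u" if "u \<noteq> 0" for u
    using R_pos that assms[of "B *v u"] by (simp add: quad_input_weight pos_def_iff_quad add_pos_nonneg)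
qed

lemma input_weight_gain:
  assumes "\<And>x. 0 \<le> quad P x"
  shows "input_weight P ** gain P = transpose B ** P ** A"
  unfolding gain_def by (rule matrix_inv_mult_cancel[OF invertible_input_weight[OF assms]])

text \<open>
  The identity that makes \<open>gain P\<close> the minimizer over all gains and measures exactly what any
  other gain loses. With $u$, $z$ the input and the next state under \<open>gain P\<close> and $d$ the
  change of input, the cross terms are $2 d \cdot (R u - B^T P z)$, and they cancel because
  $(R + B^T P B) u = B^T P A x$.
\<close>

lemma bellman_complete_square:
  assumes sym: "sym_mat P" and nonneg: "\<And>x. 0 \<le> quad P x"
  shows "quad (bellman K P) x =
    quad (bellman (gain P) P) x + quad (input_weight P) ((K - gain P) *v x)"
proof -
  define u where "u = gain P *v x"
  define z where "z = closed_loop (gain P) *v x"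
  define d where "d = (K - gain P) *v x"
  have Kx: "K *v x = u + d" by (simp add: u_def d_def matrix_vector_mult_diff_rdistrib)
  have z: "z = A *v x - B *v u"
    by (simp add: z_def u_def closed_loop_def matrix_vector_mult_diff_rdistrib
        matrix_vector_mul_assoc)
  have clx: "closed_loop K *v x = z - B *v d"
    by (simp add: z closed_loop_def matrix_vector_mult_diff_rdistrib
        matrix_vector_mul_assoc[symmetric] Kx matrix_vector_right_distrib)
  have "input_weight P *v u = transpose B *v (P *v (A *v x))"
    using arg_cong[OF input_weight_gain[OF nonneg], of "\<lambda>M. M *v x"]
    by (simp add: u_def matrix_vector_mul_assoc[symmetric] del: transpose_matrix_vector)
  then have "R *v u = transpose B *v (P *v z)"
    by (simp add: input_weight_def z matrix_vector_mult_add_rdistrib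
        matrix_vector_mult_diff_distrib matrix_vector_mul_assoc[symmetric] algebra_simps
        del: transpose_matrix_vector)
  then have "d \<bullet> (R *v u) = (B *v d) \<bullet> (P *v z)" by (simp add: inner_transpose_mult del: transpose_matrix_vector)
  then have cross: "u \<bullet> (R *v d) = z \<bullet> (P *v (B *v d))"
    using sym_mat_inner[OF sym, of z "B *v d"] sym_mat_inner[OF R_sym, of u d]
    by (simp only: inner_commute[of d] inner_commute[of "B *v d"])
  show ?thesis
    unfolding quad_bellman Kx clx quad_input_weight d_def[symmetric] u_def[symmetric]
      z_def[symmetric] quad_vector_add[OF R_sym] quad_vector_diff[OF sym]
    using cross by simp
qed

lemma bellman_gain_le:
  assumes "sym_mat P" "\<And>x. 0 \<le> quad P x"
  shows "quad (bellman (gain P) P) x \<le> quad (bellman K P) x"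
  using bellman_complete_square[OF assms, of K x] R_nonneg[of "(K - gain P) *v x"]
    assms(2)[of "B *v ((K - gain P) *v x)"]
  by (simp add: quad_input_weight)

lemma H_map_eq_bellman: "H_map (G_mat A B S R P) K = bellman K P - P"
  by (simp add: H_map_G_mat bellman_def closed_loop_def)

lemma dare_lhs_eq_bellman:
  assumes "\<And>x. 0 \<le> quad P x"
  shows "dare_lhs A B S R P = bellman (gain P) P - P"
proof -
  let ?K = "gain P"
  have "transpose ?K ** (input_weight P ** ?K) = transpose ?K ** (transpose B ** P ** A)"
    by (simp add: input_weight_gain[OF assms])
  then have cancel: "transpose ?K ** R ** ?K + transpose ?K ** transpose B ** P ** B ** ?K =
      transpose ?K ** transpose B ** P ** A"
    by (simp add: input_weight_def matrix_add_ldistrib matrix_mult_add_left matrix_mul_assoc)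
  have K: "transpose A ** P ** B ** matrix_inv (R + transpose B ** P ** B) ** transpose B ** P ** A =
      transpose A ** P ** B ** ?K"
    by (simp add: gain_def input_weight_def matrix_mul_assoc)
  show ?thesis
    using cancel unfolding dare_lhs_def K bellman_def closed_loop_def transpose_diff
      matrix_transpose_mul matrix_mult_diff_left matrix_mult_diff_right matrix_mul_assoc
    by (simp add: algebra_simps)
qed

lemma stabilizing_iff: "stabilizing A B K \<longleftrightarrow> stable (closed_loop K)"
  by (simp add: stabilizing_def closed_loop_def)

lemma bellman_fixpoint_unique:
  assumes "stabilizing A B K" "bellman K X = X" "bellman K Y = Y"
  shows "X = Y"
proof -
  let ?M = "closed_loop K"
  have "transpose ?M ** (X - Y) ** ?M = bellman K X - bellman K Y"
    by (simp add: bellman_def matrix_mult_diff_left matrix_mult_diff_right)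
  then have "X - Y = 0"
    using assms by (intro stein_unique[of ?M]) (simp_all add: stabilizing_iff)
  then show ?thesis by simp
qed

abbreviation "cost \<equiv> policy_value A B S R"

lemma cost_eqI:
  assumes "stabilizing A B K" "sym_mat P" "bellman K P = P"
  shows "cost K = P"
  unfolding policy_value_def H_map_eq_bellman
proof (rule the_equality)
  show "sym_mat P \<and> bellman K P - P = 0" using assms by simp
  show "Q = P" if "sym_mat Q \<and> bellman K Q - Q = 0" for Q
    using that by (intro bellman_fixpoint_unique[OF assms(1) _ assms(3)]) simp
qed

lemma
  assumes "stabilizing A B K"
  shows sym_cost: "sym_mat (cost K)" and bellman_cost: "bellman K (cost K) = cost K"
proof -
  have "stable (closed_loop K)" using assms by (simp add: stabilizing_iff)
  then obtain P where P: "P = transpose (closed_loop K) ** P ** closed_loop K + (S + transpose K ** R ** K)"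
    by (rule stein_solution_exists)
  have fixp: "bellman K P = P"
    unfolding bellman_def by (rule trans[OF add.assoc P[symmetric]])
  have "transpose (bellman K P) = bellman K (transpose P)"
    using S_sym R_sym
    by (simp add: bellman_def transpose_add matrix_transpose_mul matrix_mul_assoc sym_mat_def)
  then have "transpose P = P"
    unfolding fixp by (intro bellman_fixpoint_unique[OF assms _ fixp]) (rule sym)
  then have sym: "sym_mat P" by (simp add: sym_mat_def)
  have "cost K = P" by (rule cost_eqI[OF assms sym fixp])
  with fixp sym show "sym_mat (cost K)" "bellman K (cost K) = cost K" by simp_all
qed

lemma quad_cost:
  assumes "stabilizing A B K"
  shows "quad (cost K) x = quad (cost K) (closed_loop K *v x) + quad S x + quad R (K *v x)"
  using quad_bellman[of K "cost K" x] unfolding bellman_cost[OF assms] .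

lemma quad_cost_ge:
  assumes "stabilizing A B K"
  shows "quad S x + quad R (K *v x) \<le> quad (cost K) x"
    and quad_cost_nonneg: "0 \<le> quad (cost K) x"
proof -
  have nonneg: "0 \<le> quad (cost K) x" for x
  proof (rule nonneg_if_nonincreasing_along_stable[of "closed_loop K"])
    show "quad (cost K) (closed_loop K *v x) \<le> quad (cost K) x" for x
      using quad_cost[OF assms, of x] S_nonneg[of x] R_nonneg[of "K *v x"] by linarith
  qed (use assms in \<open>simp_all add: stabilizing_iff isCont_quad\<close>)
  then show "0 \<le> quad (cost K) x" .
  show "quad S x + quad R (K *v x) \<le> quad (cost K) x"
    using quad_cost[OF assms, of x] nonneg[of "closed_loop K *v x"] by linarith
qed

text \<open>
  Both matrices are compared along the closed loop of the same gain \<open>K\<close>: it is exact for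
  \<open>cost K\<close> and suboptimal for \<open>P\<close>, so \<open>cost K - P\<close> does not increase along this loop.
\<close>

lemma fixpoint_le_cost:
  assumes P: "sym_mat P" "\<And>x. 0 \<le> quad P x" "bellman (gain P) P = P" and K: "stabilizing A B K"
  shows "quad P x \<le> quad (cost K) x"
proof -
  have "0 \<le> quad (cost K - P) x"
  proof (rule nonneg_if_nonincreasing_along_stable[of "closed_loop K"])
    show "quad (cost K - P) (closed_loop K *v x) \<le> quad (cost K - P) x" for x
      using quad_cost[OF K, of x] bellman_gain_le[OF P(1,2), of x K] P(3)
      by (simp add: quad_bellman)
  qed (use K in \<open>simp_all add: stabilizing_iff isCont_quad del: quad_diff\<close>)
  then show ?thesis by simp
qed

lemma fixpoint_stabilizing:
  assumes P: "\<And>x. 0 \<le> quad P x" "bellman (gain P) P = P"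
  shows "stabilizing A B (gain P)"
  unfolding stabilizing_iff
proof (rule stable_if_lyapunov_decrease[of P])
  fix x :: "real ^ 'n" assume "x \<noteq> 0"
  then have "0 < quad S x" using S_pos by (simp add: pos_def_iff_quad)
  then show "quad P (closed_loop (gain P) *v x) < quad P x"
    using quad_bellman[of "gain P" P x] R_nonneg[of "gain P *v x"] unfolding P(2) by linarith
qed (rule P(1))

text \<open>
  Each fixed point is the cost of its own gain, which is stabilizing. So each of the two is at
  most the other.
\<close>

lemma fixpoint_unique:
  assumes P: "sym_mat P" "\<And>x. 0 \<le> quad P x" "bellman (gain P) P = P"
    and Q: "sym_mat Q" "\<And>x. 0 \<le> quad Q x" "bellman (gain Q) Q = Q"
  shows "P = Q"
proof (rule sym_mat_eqI[OF P(1) Q(1)])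
  have costs: "cost (gain P) = P" "cost (gain Q) = Q"
    by (rule cost_eqI[OF fixpoint_stabilizing[OF P(2,3)] P(1,3)],
        rule cost_eqI[OF fixpoint_stabilizing[OF Q(2,3)] Q(1,3)])
  show "quad P x = quad Q x" for x
    using fixpoint_le_cost[OF P fixpoint_stabilizing[OF Q(2,3)], of x]
      fixpoint_le_cost[OF Q fixpoint_stabilizing[OF P(2,3)], of x] costs by simp
qed

lemma bellman_gain_mono:
  assumes P: "sym_mat P" "\<And>x. 0 \<le> quad P x" and Q: "sym_mat Q" "\<And>x. 0 \<le> quad Q x"
    and le: "\<And>x. quad P x \<le> quad Q x"
  shows "quad (bellman (gain P) P) x \<le> quad (bellman (gain Q) Q) x"
  using bellman_gain_le[OF P, of x "gain Q"] le[of "closed_loop (gain Q) *v x"]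
  unfolding quad_bellman by linarith

text \<open>
  Value iteration, started from the cost of a stabilizing gain, decreases and is bounded below
  by zero. The limit is shown to be a fixed point with inequalities only: one direction by
  monotonicity of the iteration map, the other by comparing each iterate with the gain of the
  limit. This avoids continuity of the matrix inverse.
\<close>

lemma fixpoint_exists:
  assumes K: "stabilizing A B K"
  obtains P where "sym_mat P" "\<And>x. 0 \<le> quad P x" "bellman (gain P) P = P"
proof -
  define V where "V = rec_nat (cost K) (\<lambda>_ P. bellman (gain P) P)"
  have V_0: "V 0 = cost K" and V_Suc: "V (Suc k) = bellman (gain (V k)) (V k)" for k
    by (simp_all add: V_def)
  have V: "sym_mat (V k) \<and> (\<forall>x. 0 \<le> quad (V k) x)" for k
    by (induction k)
      (auto simp: V_0 V_Suc sym_cost[OF K] quad_cost_nonneg[OF K] sym_bellman quad_bellman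
        S_nonneg R_nonneg)
  have decr: "quad (V (Suc k)) x \<le> quad (V k) x" for k x
  proof (induction k arbitrary: x)
    case 0
    show ?case
      using bellman_gain_le[of "cost K" x K] sym_cost[OF K] quad_cost_nonneg[OF K]
      by (simp add: V_0 V_Suc bellman_cost[OF K])
  next
    case (Suc k)
    then show ?case
      using bellman_gain_mono[of "V (Suc k)" "V k" x] V by (simp add: V_Suc[symmetric])
  qed
  obtain P where lim: "V \<longlonglongrightarrow> P" and sym: "sym_mat P" and le: "\<And>k x. quad P x \<le> quad (V k) x"
    using decreasing_quad_convergent[of V] V decr by blast
  have nonneg: "0 \<le> quad P x" for x
    using LIMSEQ_le_const[OF tendsto_quad[OF lim]] V by blast
  have "bellman (gain P) P = P"
  proof (rule sym_mat_eqI[OF sym_bellman[OF sym] sym])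
    fix x
    have "quad (bellman (gain P) P) x \<le> quad (V (Suc k)) x" for k
      using bellman_gain_mono[of P "V k" x] V le sym nonneg by (simp add: V_Suc)
    then have le1: "quad (bellman (gain P) P) x \<le> quad P x"
      using LIMSEQ_le_const[OF LIMSEQ_Suc[OF tendsto_quad[OF lim]]] by blast
    have "quad P x \<le> quad (bellman (gain P) (V k)) x" for k
      using le[of x "Suc k"] bellman_gain_le[of "V k" x "gain P"] V by (force simp: V_Suc)
    moreover have "(\<lambda>k. quad (bellman (gain P) (V k)) x) \<longlonglongrightarrow> quad (bellman (gain P) P) x"
      unfolding quad_bellman by (intro tendsto_intros tendsto_quad lim)
    ultimately have "quad P x \<le> quad (bellman (gain P) P) x" using LIMSEQ_le_const by blast
    with le1 show "quad (bellman (gain P) P) x = quad P x" by simp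
  qed
  with sym nonneg show ?thesis using that by blast
qed

lemma
  assumes "stabilizing A B K"
  shows P_star_pos: "pos_def (P_star A B S R)"
    and P_star_fixpoint: "bellman (gain (P_star A B S R)) (P_star A B S R) = P_star A B S R"
proof -
  obtain P where P: "sym_mat P" "\<And>x. 0 \<le> quad P x" "bellman (gain P) P = P"
    using fixpoint_exists[OF assms] by blast
  have "0 < quad P x" if "x \<noteq> 0" for x
    using quad_bellman[of "gain P" P x] P(2) P(3) R_nonneg[of "gain P *v x"] S_pos that
    by (simp add: pos_def_iff_quad add_nonneg_pos add_pos_nonneg)
  with P have pos: "pos_def P" by (simp add: pos_def_iff_quad)
  have "P_star A B S R = P"
    unfolding P_star_def
  proof (rule the_equality)
    show "pos_def P \<and> dare_lhs A B S R P = 0"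
      using pos P by (simp add: dare_lhs_eq_bellman)
    show "Q = P" if Q: "pos_def Q \<and> dare_lhs A B S R Q = 0" for Q
    proof (rule fixpoint_unique[OF _ _ _ P])
      show nonneg: "0 \<le> quad Q x" for x using Q by (simp add: pos_def_quad_nonneg)
      show "sym_mat Q" using Q by (simp add: pos_def_def)
      show "bellman (gain Q) Q = Q" using Q by (simp add: dare_lhs_eq_bellman[OF nonneg])
    qed
  qed
  with pos P(3) show "pos_def (P_star A B S R)"
    "bellman (gain (P_star A B S R)) (P_star A B S R) = P_star A B S R" by simp_all
qed

text \<open>
  One step with an inexact gain \<open>K'\<close>. By completion of the square, \<open>K'\<close> costs, in one step,
  the minimal amount plus the quadratic error term. If this term is at most a fraction \<open>\<eta>\<close> of
  the state cost \<open>S\<close>, the old cost is still a Lyapunov function for \<open>K'\<close>. For the bound,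
  compare the minimal one-step cost \<open>T\<close> with \<open>(1 - \<eta>) * cost K'\<close> along the closed loop of
  \<open>K'\<close>: their difference does not increase. Keeping \<open>T\<close>, and not only the old cost, on the
  right-hand side is what later yields contraction.
\<close>

lemma inexact_improvement:
  assumes K: "stabilizing A B K" and \<eta>: "0 \<le> \<eta>" "\<eta> < 1"
    and error: "\<And>x. quad (input_weight (cost K)) ((K' - gain (cost K)) *v x) \<le> \<eta> * quad S x"
  shows "stabilizing A B K'"
    and "(1 - \<eta>) * quad (cost K') x \<le> quad (bellman (gain (cost K)) (cost K)) x"
proof -
  define P where "P = cost K"
  define T where "T = bellman (gain P) P"
  have P: "sym_mat P" "\<And>x. 0 \<le> quad P x"
    using K by (simp_all add: P_def sym_cost quad_cost_nonneg)
  have T_le: "quad T x \<le> quad P x" for x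
    using bellman_gain_le[OF P, of x K] bellman_cost[OF K] by (simp add: P_def T_def)
  have next_P: "quad P (closed_loop K' *v x) + quad S x + quad R (K' *v x) \<le> quad T x + \<eta> * quad S x"
    for x
    using bellman_complete_square[OF P, of K' x] error[of x]
    by (simp add: quad_bellman[of K'] T_def P_def)
  show K': "stabilizing A B K'"
    unfolding stabilizing_iff
  proof (rule stable_if_lyapunov_decrease[OF P(2)])
    fix x :: "real ^ 'n" assume "x \<noteq> 0"
    then have "\<eta> * quad S x < quad S x" using S_pos \<eta>(2) by (simp add: pos_def_iff_quad)
    then show "quad P (closed_loop K' *v x) < quad P x"
      using next_P[of x] T_le[of x] R_nonneg[of "K' *v x"] by linarith
  qed
  let ?f = "\<lambda>x. quad T x - (1 - \<eta>) * quad (cost K') x"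
  have "0 \<le> ?f x"
  proof (rule nonneg_if_nonincreasing_along_stable[of "closed_loop K'" ?f])
    fix x
    have "(1 - \<eta>) * quad (cost K') x = (1 - \<eta>) * quad (cost K') (closed_loop K' *v x) +
        (1 - \<eta>) * quad S x + (1 - \<eta>) * quad R (K' *v x)"
      by (subst quad_cost[OF K']) (simp add: algebra_simps)
    moreover have "(1 - \<eta>) * quad R (K' *v x) \<le> quad R (K' *v x)"
      using \<eta>(1) R_nonneg[of "K' *v x"] by (simp add: mult_left_le_one_le algebra_simps)
    moreover have "(1 - \<eta>) * quad S x = quad S x - \<eta> * quad S x" by (simp add: algebra_simps)
    ultimately show "?f (closed_loop K' *v x) \<le> ?f x"
      using next_P[of x] T_le[of "closed_loop K' *v x"] by linarith
  qed (use K' in \<open>auto simp: stabilizing_iff intro!: continuous_intros isCont_quad\<close>)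
  then show "(1 - \<eta>) * quad (cost K') x \<le> quad (bellman (gain (cost K)) (cost K)) x"
    by (simp add: T_def P_def)
qed

end

section \<open>Contraction towards the optimal cost\<close>

locale stabilizable_lqr = lqr A S B R
  for A S :: "real ^ 'n ^ 'n" and B :: "real ^ 'm ^ 'n" and R :: "real ^ 'm ^ 'm" +
  assumes stabilizable: "\<exists>K. stabilizing A B K"
begin

abbreviation "Pstar \<equiv> P_star A B S R"

lemma Pstar_pos: "pos_def Pstar"
  and Pstar_fixpoint: "bellman (gain Pstar) Pstar = Pstar"
  using stabilizable P_star_pos P_star_fixpoint by blast+

lemma Pstar_sym: "sym_mat Pstar"
  using Pstar_pos by (simp add: pos_def_def)

lemma Pstar_nonneg: "0 \<le> quad Pstar x"
  using Pstar_pos by (rule pos_def_quad_nonneg)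

lemma Pstar_le_cost: "stabilizing A B K \<Longrightarrow> quad Pstar x \<le> quad (cost K) x"
  by (rule fixpoint_le_cost[OF Pstar_sym Pstar_nonneg Pstar_fixpoint])

text \<open>
  Along the optimal loop \<open>Pstar\<close> decreases by at least \<open>S\<close>, and \<open>S\<close> dominates a fixed
  fraction of \<open>Pstar\<close> since it is positive definite.
\<close>

lemma optimal_closed_loop_contracts:
  obtains \<rho> where "0 \<le> \<rho>" "\<rho> < 1"
    "\<And>x. quad Pstar (closed_loop (gain Pstar) *v x) \<le> \<rho> * quad Pstar x"
proof -
  obtain s where s: "0 < s" "\<And>x. s * (norm x)\<^sup>2 \<le> quad S x"
    using pos_def_lower_bound[OF S_pos] by blast
  \<comment> \<open>The denominator makes \<open>t\<close> at most 1, which keeps the contraction factor nonnegative.\<close>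
  define t where "t = s / (norm Pstar + s)"
  have t: "0 < t" "t \<le> 1" using s(1) by (simp_all add: t_def divide_simps add_nonneg_pos)
  have "quad Pstar (closed_loop (gain Pstar) *v x) \<le> (1 - t) * quad Pstar x" for x
  proof -
    have "quad Pstar x \<le> (norm Pstar + s) * (norm x)\<^sup>2"
      using quad_le_norm[of Pstar x] mult_nonneg_nonneg[OF less_imp_le[OF s(1)] zero_le_power2[of "norm x"]]
      unfolding distrib_right by linarith
    then have "t * quad Pstar x \<le> t * ((norm Pstar + s) * (norm x)\<^sup>2)"
      using t(1) by (intro mult_left_mono) auto
    also have "\<dots> = s * (norm x)\<^sup>2"
      using s(1) by (simp add: t_def add_nonneg_pos less_imp_neq[symmetric])
    finally have "t * quad Pstar x \<le> quad S x" using s(2)[of x] by linarith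
    then show ?thesis
      using quad_bellman[of "gain Pstar" Pstar x] R_nonneg[of "gain Pstar *v x"]
      by (simp add: Pstar_fixpoint algebra_simps)
  qed
  with t show ?thesis by (intro that[of "1 - t"]) auto
qed

lemma norm_cost_diff_le:
  assumes K: "stabilizing A B K" and c: "0 \<le> c" "\<And>x. quad (cost K) x \<le> (1 + c) * quad Pstar x"
  shows "norm (cost K - Pstar) \<le> 2 * real CARD('n) * real CARD('n) * norm Pstar * c"
proof -
  have "norm (cost K - Pstar) \<le> 2 * real CARD('n) * real CARD('n) * (c * norm Pstar)"
  proof (rule norm_le_if_quad_bounded)
    show "sym_mat (cost K - Pstar)"
      using sym_cost[OF K] Pstar_sym by (simp add: sym_mat_def transpose_diff)
    show "0 \<le> quad (cost K - Pstar) x" for x using Pstar_le_cost[OF K, of x] by simp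
    show "quad (cost K - Pstar) x \<le> c * norm Pstar * (norm x)\<^sup>2" for x
      using c(2)[of x] mult_left_mono[OF quad_le_norm[of Pstar x] c(1)] by (simp add: algebra_simps)
  qed
  then show ?thesis by (simp add: mult_ac)
qed

lemma cost_le_multiple_Pstar:
  obtains C where "0 < C" "\<And>x. quad (cost K) x \<le> (1 + C) * quad Pstar x"
proof -
  obtain p where p: "0 < p" "\<And>x. p * (norm x)\<^sup>2 \<le> quad Pstar x"
    using pos_def_lower_bound[OF Pstar_pos] by blast
  define C where "C = norm (cost K) / p + 1"
  have "quad (cost K) x \<le> (1 + C) * quad Pstar x" for x
  proof -
    have "quad (cost K) x \<le> norm (cost K) / p * (p * (norm x)\<^sup>2)"
      using quad_le_norm[of "cost K" x] p(1) by simp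
    also have "\<dots> \<le> (1 + C) * quad Pstar x"
      using p(1) p(2)[of x] by (intro mult_mono) (auto simp: C_def)
    finally show ?thesis .
  qed
  moreover have "0 < C" using p(1) by (simp add: C_def add_nonneg_pos)
  ultimately show ?thesis using that by blast
qed

text \<open>
  The minimal one-step cost is at most that of the optimal gain, for which the excess
  \<open>c * Pstar\<close> over \<open>Pstar\<close> shrinks by the factor \<open>\<rho>\<close>. Division by \<open>1 - \<eta>\<close> costs a
  factor of at most \<open>1 + 2 * \<eta>\<close>, as \<open>\<eta> \<le> 1 / 2\<close>.
\<close>

lemma inexact_improvement_contracts:
  assumes K: "stabilizing A B K" and c: "0 \<le> c" "\<And>x. quad (cost K) x \<le> (1 + c) * quad Pstar x"
    and \<eta>: "0 \<le> \<eta>" "\<eta> \<le> 1 / 2"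
    and error: "\<And>x. quad (input_weight (cost K)) ((K' - gain (cost K)) *v x) \<le> \<eta> * quad S x"
    and \<rho>: "0 \<le> \<rho>" "\<rho> < 1" "\<And>x. quad Pstar (closed_loop (gain Pstar) *v x) \<le> \<rho> * quad Pstar x"
  shows "quad (cost K') x \<le> (1 + (\<rho> * c + 2 * \<eta> * (1 + c))) * quad Pstar x"
proof -
  let ?P = "cost K" and ?Ks = "gain Pstar"
  have K': "stabilizing A B K'" and
    impr: "(1 - \<eta>) * quad (cost K') x \<le> quad (bellman (gain ?P) ?P) x"
    using inexact_improvement[OF K \<eta>(1) _ error] \<eta>(2) by simp_all
  have "quad (bellman (gain ?P) ?P) x \<le> quad (bellman ?Ks ?P) x"
    by (rule bellman_gain_le[OF sym_cost[OF K] quad_cost_nonneg[OF K]])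
  also have "\<dots> \<le> (1 + c) * quad Pstar (closed_loop ?Ks *v x) + quad S x + quad R (?Ks *v x)"
    using c(2) by (simp add: quad_bellman)
  also have "\<dots> = quad Pstar x + c * quad Pstar (closed_loop ?Ks *v x)"
    using quad_bellman[of ?Ks Pstar x] by (simp add: Pstar_fixpoint algebra_simps)
  also have "\<dots> \<le> (1 + \<rho> * c) * quad Pstar x"
    using mult_left_mono[OF \<rho>(3)[of x] c(1)] by (simp add: algebra_simps)
  finally have T: "(1 - \<eta>) * quad (cost K') x \<le> (1 + \<rho> * c) * quad Pstar x" using impr by linarith
  \<comment> \<open>The product is $1 + \eta - 2 \eta^2$ with $\eta \le 1/2$.\<close>
  have "1 \<le> (1 + 2 * \<eta>) * (1 - \<eta>)"
    using mult_left_mono[OF \<eta>(2,1)] by (simp add: algebra_simps)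
  then have "quad (cost K') x \<le> ((1 + 2 * \<eta>) * (1 - \<eta>)) * quad (cost K') x"
    using quad_cost_nonneg[OF K', of x] by (simp add: mult_le_cancel_right1)
  also have "\<dots> \<le> (1 + 2 * \<eta>) * ((1 + \<rho> * c) * quad Pstar x)"
    unfolding mult.assoc using T \<eta>(1) by (intro mult_left_mono) auto
  also have "\<dots> \<le> (1 + (\<rho> * c + 2 * \<eta> * (1 + c))) * quad Pstar x"
  proof -
    have "\<rho> * c \<le> c" using \<rho> c(1) by (simp add: mult_left_le_one_le)
    then have "2 * \<eta> * (1 + \<rho> * c) \<le> 2 * \<eta> * (1 + c)" using \<eta>(1) by (intro mult_left_mono) auto
    then have "(1 + 2 * \<eta>) * (1 + \<rho> * c) \<le> 1 + (\<rho> * c + 2 * \<eta> * (1 + c))"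
      by (simp add: algebra_simps)
    then show ?thesis
      unfolding mult.assoc[symmetric] using Pstar_nonneg by (intro mult_right_mono) auto
  qed
  finally show ?thesis .
qed

section \<open>Inexact policy iteration\<close>

definition next_gain :: "real ^ 'n ^ 'n \<Rightarrow>
    real ^ ('n::finite + 'm::finite) ^ ('n::finite + 'm::finite) \<Rightarrow> real ^ 'n ^ 'm" where
  "next_gain P \<Delta> =
     matrix_inv (block_uu (G_mat A B S R P + \<Delta>)) ** block_ux (G_mat A B S R P + \<Delta>)"

lemma block_uu_perturbed: "block_uu (G_mat A B S R P + \<Delta>) = input_weight P + block_uu \<Delta>"
  by (simp add: vec_eq_iff block_uu_def G_mat_def block_mat_def input_weight_def)

lemma block_ux_perturbed: "block_ux (G_mat A B S R P + \<Delta>) = transpose B ** P ** A + block_ux \<Delta>"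
  by (simp add: vec_eq_iff block_ux_def G_mat_def block_mat_def)

text \<open>
  Uniform version of the previous estimate. As long as the relative error is at most \<open>C\<close>, the
  norms of the cost, of its greedy gain and of the input weight are bounded by the constants \<open>b\<close>,
  \<open>g\<close> and \<open>w\<close> of the proof. Hence a disturbance of norm $d$ changes the gain by at most a
  multiple of $d$, and the resulting error is at most $q d^2$ relative to \<open>S\<close>.
\<close>

lemma inexact_step:
  assumes "0 \<le> C"
  obtains \<rho> \<delta>0 L where "0 \<le> \<rho>" "\<rho> < 1" "0 < \<delta>0" "0 \<le> L"
    and "\<And>K c \<Delta>. stabilizing A B K \<Longrightarrow> 0 \<le> c \<Longrightarrow> c \<le> C \<Longrightarrow>
      (\<And>x. quad (cost K) x \<le> (1 + c) * quad Pstar x) \<Longrightarrow> norm \<Delta> \<le> \<delta>0 \<Longrightarrow>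
      invertible (block_uu (G_mat A B S R (cost K) + \<Delta>)) \<and>
      stabilizing A B (next_gain (cost K) \<Delta>) \<and>
      (\<forall>x. quad (cost (next_gain (cost K) \<Delta>)) x \<le> (1 + (\<rho> * c + L * norm \<Delta>)) * quad Pstar x)"
proof -
  obtain \<rho> where \<rho>: "0 \<le> \<rho>" "\<rho> < 1"
    "\<And>x. quad Pstar (closed_loop (gain Pstar) *v x) \<le> \<rho> * quad Pstar x"
    using optimal_closed_loop_contracts by blast
  obtain s where s: "0 < s" "\<And>x. s * (norm x)\<^sup>2 \<le> quad S x"
    using pos_def_lower_bound[OF S_pos] by blast
  obtain r where r: "0 < r" "\<And>u. r * (norm u)\<^sup>2 \<le> quad R u"
    using pos_def_lower_bound[OF R_pos] by blast
  define b where "b = norm Pstar + 2 * real CARD('n) * real CARD('n) * norm Pstar * C"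
  define g where "g = norm B * b * norm A / r"
  define w where "w = norm R + norm B * b * norm B"
  define q where "q = w / s * (2 * (1 + g) / r)\<^sup>2"
  define \<delta>0 where "\<delta>0 = Min {1, r / 2, 1 / (2 * (q + 1))}"
  define L where "L = 2 * q * (1 + C)"
  have b: "0 \<le> b" using assms by (simp add: b_def)
  then have g: "0 \<le> g" and w: "0 \<le> w" using r(1) by (simp_all add: g_def w_def)
  then have q: "0 \<le> q" using s(1) by (simp add: q_def)
  have \<delta>0: "0 < \<delta>0" "\<delta>0 \<le> 1" "\<delta>0 \<le> r / 2" "\<delta>0 \<le> 1 / (2 * (q + 1))"
    using r(1) q by (simp_all add: \<delta>0_def)
  have L: "0 \<le> L" using q assms by (simp add: L_def)
  have step: "invertible (block_uu (G_mat A B S R (cost K) + \<Delta>)) \<and>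
      stabilizing A B (next_gain (cost K) \<Delta>) \<and>
      (\<forall>x. quad (cost (next_gain (cost K) \<Delta>)) x \<le> (1 + (\<rho> * c + L * norm \<Delta>)) * quad Pstar x)"
    if K: "stabilizing A B K" and c: "0 \<le> c" "c \<le> C" "\<And>x. quad (cost K) x \<le> (1 + c) * quad Pstar x"
      and \<Delta>: "norm \<Delta> \<le> \<delta>0" for K c \<Delta>
  proof -
    let ?P = "cost K" and ?\<delta> = "norm \<Delta>"
    let ?W = "input_weight ?P"
    let ?E = "next_gain ?P \<Delta> - gain ?P"
    note P_nonneg = quad_cost_nonneg[OF K]
    have "norm ?P \<le> norm Pstar + norm (?P - Pstar)" by (metis add_diff_cancel_left' diff_add_cancel norm_triangle_sub)
    also have "\<dots> \<le> b"
      unfolding b_def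
      by (intro add_left_mono order_trans[OF norm_cost_diff_le[OF K c(1,3)]] mult_left_mono c(2)) simp
    finally have P_b: "norm ?P \<le> b" .
    have sandwich: "norm (transpose B ** ?P ** Y) \<le> norm B * b * norm Y" for Y :: "real ^ 'k ^ 'n"
    proof -
      have "norm (transpose B ** ?P ** Y) \<le> norm (transpose B ** ?P) * norm Y" by (rule norm_matrix_mult_le)
      also have "\<dots> \<le> (norm (transpose B) * norm ?P) * norm Y"
        by (intro mult_right_mono norm_matrix_mult_le) simp
      also have "\<dots> \<le> norm B * b * norm Y"
        unfolding norm_transpose using P_b by (intro mult_right_mono mult_left_mono) auto
      finally show ?thesis .
    qed
    have W_lower: "r * (norm u)\<^sup>2 \<le> quad ?W u" for u
      using r(2)[of u] P_nonneg[of "B *v u"] by (simp add: quad_input_weight)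
    have W_w: "norm ?W \<le> w"
      unfolding input_weight_def w_def using norm_triangle_ineq sandwich by (meson add_left_mono order_trans)
    have "r * norm (gain ?P) \<le> norm B * b * norm A"
      using norm_le_norm_mult_if_quad_ge[OF r(1) W_lower, of "gain ?P"] sandwich[of A]
      by (simp add: input_weight_gain[OF P_nonneg])
    then have gain_g: "norm (gain ?P) \<le> g" using r(1) by (simp add: g_def field_simps)
    have solve: "invertible (?W + block_uu \<Delta>)" "norm ?E \<le> 2 * ?\<delta> / r * (1 + norm (gain ?P))"
      using perturbed_linear_solution[OF r(1) W_lower input_weight_gain[OF P_nonneg]
          norm_block_uu_le[of \<Delta>] norm_block_ux_le[of \<Delta>]] \<Delta> \<delta>0(3)
      by (simp_all add: next_gain_def block_uu_perturbed block_ux_perturbed)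
    have "norm ?E \<le> 2 * ?\<delta> / r * (1 + g)"
      using gain_g r(1) by (intro order_trans[OF solve(2)] mult_left_mono) auto
    then have E: "(norm ?E)\<^sup>2 \<le> (2 * (1 + g) / r)\<^sup>2 * ?\<delta>\<^sup>2"
      using power_mono[of "norm ?E" _ 2] by (simp add: power_mult_distrib[symmetric] mult_ac)
    define \<eta> where "\<eta> = q * ?\<delta>"
    have error: "quad ?W (?E *v x) \<le> \<eta> * quad S x" for x
    proof -
      have "quad ?W (?E *v x) \<le> norm ?W * (norm (?E *v x))\<^sup>2" by (rule quad_le_norm)
      also have "\<dots> \<le> w * (norm ?E * norm x)\<^sup>2"
        using W_w w by (intro mult_mono power_mono norm_matrix_vector_mult_le) auto
      also have "\<dots> = w * (norm ?E)\<^sup>2 * (norm x)\<^sup>2" by (simp add: power_mult_distrib)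
      also have "\<dots> \<le> w * ((2 * (1 + g) / r)\<^sup>2 * ?\<delta>\<^sup>2) * (norm x)\<^sup>2"
        using E w by (intro mult_right_mono mult_left_mono) auto
      also have "\<dots> = q * ?\<delta>\<^sup>2 * (s * (norm x)\<^sup>2)" using s(1) by (simp add: q_def)
      also have "\<dots> \<le> q * ?\<delta> * quad S x"
      proof (intro mult_mono)
        \<comment> \<open>The error is quadratic in the disturbance; a linear bound is enough.\<close>
        have "?\<delta> * ?\<delta> \<le> ?\<delta> * 1" using \<Delta> \<delta>0(2) by (intro mult_left_mono) auto
        then show "?\<delta>\<^sup>2 \<le> ?\<delta>" by (simp add: power2_eq_square)
      qed (use q s in auto)
      finally show ?thesis by (simp add: \<eta>_def)
    qed
    have "q * ?\<delta> \<le> q * (1 / (2 * (q + 1)))" using \<Delta> \<delta>0(4) q by (intro mult_left_mono) auto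
    also have "\<dots> \<le> 1 / 2" using q by (simp add: field_simps)
    finally have \<eta>: "0 \<le> \<eta>" "\<eta> \<le> 1 / 2" using q by (simp_all add: \<eta>_def)
    have "2 * \<eta> * (1 + c) \<le> 2 * \<eta> * (1 + C)" using c(2) \<eta>(1) by (intro mult_left_mono) auto
    then have "1 + (\<rho> * c + 2 * \<eta> * (1 + c)) \<le> 1 + (\<rho> * c + L * ?\<delta>)"
      by (simp add: L_def \<eta>_def mult_ac)
    then have "quad (cost (next_gain ?P \<Delta>)) x \<le> (1 + (\<rho> * c + L * ?\<delta>)) * quad Pstar x" for x
      using inexact_improvement_contracts[OF K c(1,3) \<eta> error \<rho>, of x]
        mult_right_mono[OF _ Pstar_nonneg] order_trans by blast
    moreover have "stabilizing A B (next_gain ?P \<Delta>)"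
      using inexact_improvement(1)[OF K \<eta>(1) _ error] \<eta>(2) by simp
    ultimately show ?thesis using solve(1) by (simp add: block_uu_perturbed)
  qed
  show ?thesis by (rule that[OF \<rho>(1,2) \<delta>0(1) L step])
qed

text \<open>
  The input cost of \<open>K\<close> is part of \<open>cost K\<close>, and \<open>R\<close> is coercive.
\<close>

lemma gain_bounded_if_cost_bounded:
  obtains \<kappa> where "0 < \<kappa>" "\<And>K. stabilizing A B K \<Longrightarrow> norm (cost K) \<le> b \<Longrightarrow> norm K < \<kappa>"
proof -
  obtain r where r: "0 < r" "\<And>u. r * (norm u)\<^sup>2 \<le> quad R u"
    using pos_def_lower_bound[OF R_pos] by blast
  let ?Y = "sqrt (b / r) *\<^sub>R (mat 1 :: real ^ 'n ^ 'n)"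
  have "norm K < norm ?Y + 1" if K: "stabilizing A B K" and b: "norm (cost K) \<le> b" for K
  proof -
    have "norm (K *v x) \<le> norm (?Y *v x)" for x
    proof -
      have "r * (norm (K *v x))\<^sup>2 \<le> quad (cost K) x"
        using r(2)[of "K *v x"] quad_cost_ge[OF K, of x] S_nonneg[of x] by linarith
      also have "\<dots> \<le> b * (norm x)\<^sup>2"
        by (rule order_trans[OF quad_le_norm mult_right_mono[OF b]]) simp
      finally have "(norm (K *v x))\<^sup>2 \<le> (b / r) * (norm x)\<^sup>2" using r(1) by (simp add: field_simps)
      then have "norm (K *v x) \<le> sqrt ((b / r) * (norm x)\<^sup>2)" by (rule real_le_rsqrt)
      then have "norm (K *v x) \<le> sqrt (b / r) * norm x"
        by (simp only: real_sqrt_mult real_sqrt_abs abs_norm_cancel)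
      moreover have "0 \<le> sqrt (b / r)" using order_trans[OF norm_ge_zero b] r(1) by simp
      then have "norm (?Y *v x) = sqrt (b / r) * norm x"
        by (simp only: scaleR_matrix_vector_assoc[symmetric] norm_scaleR matrix_vector_mul_lid
            abs_of_nonneg)
      ultimately show ?thesis by simp
    qed
    then have "norm K \<le> norm ?Y" by (rule norm_le_columnwise)
    then show ?thesis by simp
  qed
  then show ?thesis by (intro that[of "norm ?Y + 1"]) (simp_all add: add_nonneg_pos)
qed

lemma K_hat_Suc_Suc:
  "K_hat A B S R K1 \<Delta>G (Suc (Suc j)) = next_gain (cost (K_hat A B S R K1 \<Delta>G (Suc j))) (\<Delta>G (Suc j))"
  by (simp add: next_gain_def Let_def)

text \<open>
  The whole iteration is governed by the scalar recursion for \<open>c\<close>, an upper bound for the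
  error relative to \<open>Pstar\<close>. The admissible disturbances keep its inhomogeneity below
  \<open>(1 - \<rho>) * b\<close>, so that \<open>c\<close> never leaves the interval from 0 to \<open>C\<close> and eventually comes
  close to the interval from 0 to \<open>b\<close>; the number \<open>b\<close> is chosen from \<open>\<epsilon>\<close>.
\<close>

lemma inexact_policy_iteration_robust:
  assumes K1: "stabilizing A B K1" and \<epsilon>: "0 < \<epsilon>"
  obtains \<delta> Pmax \<kappa> where "0 < \<delta>" "0 < Pmax" "0 < \<kappa>"
    and "\<And>\<Delta>G i. sup_norm \<Delta>G < ereal \<delta> \<Longrightarrow> 1 \<le> i \<Longrightarrow>
      invertible (block_uu (G_hat A B S R K1 \<Delta>G i)) \<and>
      stabilizing A B (K_hat A B S R K1 \<Delta>G i) \<and>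
      norm (P_tilde A B S R K1 \<Delta>G i) < Pmax \<and> norm (K_hat A B S R K1 \<Delta>G i) < \<kappa>"
    and "\<And>\<Delta>G. sup_norm \<Delta>G < ereal \<delta> \<Longrightarrow>
      limsup (\<lambda>i. ereal (norm (P_tilde A B S R K1 \<Delta>G i - Pstar))) < ereal \<epsilon>"
    and "\<And>\<Delta>G. sup_norm \<Delta>G < ereal \<delta> \<Longrightarrow> (\<lambda>i. norm (\<Delta>G i)) \<longlonglongrightarrow> 0 \<Longrightarrow>
      (\<lambda>i. norm (P_tilde A B S R K1 \<Delta>G i - Pstar)) \<longlonglongrightarrow> 0"
proof -
  obtain C where C: "0 < C" "\<And>x. quad (cost K1) x \<le> (1 + C) * quad Pstar x"
    using cost_le_multiple_Pstar by blast
  obtain \<rho> \<delta>0 L where \<rho>: "0 \<le> \<rho>" "\<rho> < 1" and \<delta>0: "0 < \<delta>0" and L: "0 \<le> L"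
    and step: "\<And>K c \<Delta>. stabilizing A B K \<Longrightarrow> 0 \<le> c \<Longrightarrow> c \<le> C \<Longrightarrow>
      (\<And>x. quad (cost K) x \<le> (1 + c) * quad Pstar x) \<Longrightarrow> norm \<Delta> \<le> \<delta>0 \<Longrightarrow>
      invertible (block_uu (G_mat A B S R (cost K) + \<Delta>)) \<and>
      stabilizing A B (next_gain (cost K) \<Delta>) \<and>
      (\<forall>x. quad (cost (next_gain (cost K) \<Delta>)) x \<le> (1 + (\<rho> * c + L * norm \<Delta>)) * quad Pstar x)"
    using inexact_step[OF less_imp_le[OF C(1)]] by blast
  \<comment> \<open>\<open>N\<close> converts relative errors into Frobenius distances. Below, \<open>N + 1\<close> and \<open>L + 1\<close> serve as
    denominators because \<open>N\<close> and \<open>L\<close> are only known to be nonnegative.\<close>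
  define N where "N = 2 * real CARD('n) * real CARD('n) * norm Pstar"
  have N: "0 \<le> N" by (simp add: N_def)
  define b where "b = min C (\<epsilon> / 2 / (N + 1))"
  define \<delta> where "\<delta> = min \<delta>0 ((1 - \<rho>) * b / (L + 1))"
  define Pmax where "Pmax = norm Pstar + N * C + 1"
  have b: "0 < b" "b \<le> C" using C(1) \<epsilon> N by (simp_all add: b_def)
  have cancel: "x * (y / x) = y" if "x \<noteq> 0" for x y :: real
    using that by simp
  have Nb: "N * b \<le> \<epsilon> / 2"
  proof -
    have "N * b \<le> (N + 1) * (\<epsilon> / 2 / (N + 1))"
      using N b by (intro mult_mono) (auto simp: b_def)
    also have "\<dots> = \<epsilon> / 2" by (rule cancel) (use N in simp)
    finally show ?thesis .
  qed
  have \<delta>: "0 < \<delta>" "\<delta> \<le> \<delta>0" using \<delta>0 b \<rho> L by (simp_all add: \<delta>_def)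
  have L\<delta>: "L * \<delta> \<le> (1 - \<rho>) * b"
  proof -
    have "L * \<delta> \<le> (L + 1) * ((1 - \<rho>) * b / (L + 1))"
      using L \<delta> by (intro mult_mono) (auto simp: \<delta>_def)
    also have "\<dots> = (1 - \<rho>) * b" by (rule cancel) (use L in simp)
    finally show ?thesis .
  qed
  have Pmax: "0 < Pmax" using N C(1) by (simp add: Pmax_def add_nonneg_pos)
  obtain \<kappa> where \<kappa>: "0 < \<kappa>" "\<And>K. stabilizing A B K \<Longrightarrow> norm (cost K) \<le> Pmax \<Longrightarrow> norm K < \<kappa>"
    using gain_bounded_if_cost_bounded by blast
  have main: "(\<forall>i\<ge>1. invertible (block_uu (G_hat A B S R K1 \<Delta>G i)) \<and>
        stabilizing A B (K_hat A B S R K1 \<Delta>G i) \<and>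
        norm (P_tilde A B S R K1 \<Delta>G i) < Pmax \<and> norm (K_hat A B S R K1 \<Delta>G i) < \<kappa>) \<and>
      limsup (\<lambda>i. ereal (norm (P_tilde A B S R K1 \<Delta>G i - Pstar))) < ereal \<epsilon> \<and>
      ((\<lambda>i. norm (\<Delta>G i)) \<longlonglongrightarrow> 0 \<longrightarrow>
        (\<lambda>i. norm (P_tilde A B S R K1 \<Delta>G i - Pstar)) \<longlonglongrightarrow> 0)"
    if small: "sup_norm \<Delta>G < ereal \<delta>" for \<Delta>G :: "nat \<Rightarrow> real ^ ('n + 'm) ^ ('n + 'm)"
  proof -
    have \<Delta>G: "norm (\<Delta>G (Suc j)) < \<delta>" for j
    proof -
      have "ereal (norm (\<Delta>G (Suc j))) \<le> sup_norm \<Delta>G"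
        unfolding sup_norm_def by (rule SUP_upper) simp
      then show ?thesis using small by (metis ereal_less_eq(3) le_less_trans less_ereal.simps(1))
    qed
    \<comment> \<open>The iteration starts at index 1, while the scalar recursion starts at 0.\<close>
    let ?K = "\<lambda>j. K_hat A B S R K1 \<Delta>G (Suc j)"
    define c where "c = rec_nat C (\<lambda>j c. \<rho> * c + L * norm (\<Delta>G (Suc j)))"
    have c_0: "c 0 = C" and c_Suc: "c (Suc j) = \<rho> * c j + L * norm (\<Delta>G (Suc j))" for j
      by (simp_all add: c_def)
    have noise: "L * norm (\<Delta>G (Suc j)) \<le> (1 - \<rho>) * b" for j
      using mult_left_mono[OF less_imp_le[OF \<Delta>G[of j]] L] L\<delta> by linarith
    have c_nonneg: "0 \<le> c j" for j
      by (induction j) (use C(1) \<rho>(1) L in \<open>simp_all add: c_0 c_Suc\<close>)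
    have c_le_C: "c j \<le> C" for j
    proof (induction j)
      case (Suc j)
      have "c (Suc j) \<le> \<rho> * C + (1 - \<rho>) * C"
        unfolding c_Suc using noise[of j] b(2) \<rho>
        by (intro add_mono mult_left_mono Suc) (auto intro: order_trans mult_left_mono)
      then show ?case by (simp add: algebra_simps)
    qed (simp add: c_0)
    have inv: "stabilizing A B (?K j) \<and> (\<forall>x. quad (cost (?K j)) x \<le> (1 + c j) * quad Pstar x)" for j
    proof (induction j)
      case 0
      show ?case using K1 C(2) by (simp add: c_0)
    next
      case (Suc j)
      then show ?case
        using step[of "?K j" "c j" "\<Delta>G (Suc j)"] c_nonneg[of j] c_le_C[of j] \<Delta>G[of j] \<delta>(2)
        unfolding K_hat_Suc_Suc c_Suc by simp
    qed
    have dist: "norm (cost (?K j) - Pstar) \<le> N * c j" for j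
      using norm_cost_diff_le[of "?K j" "c j"] inv[of j] c_nonneg[of j] by (simp add: N_def)
    have bounds: "invertible (block_uu (G_hat A B S R K1 \<Delta>G (Suc j)))
           \<and> stabilizing A B (?K j) \<and> norm (P_tilde A B S R K1 \<Delta>G (Suc j)) < Pmax \<and> norm (?K j) < \<kappa>"
      for j
    proof -
      have "norm (cost (?K j)) \<le> norm Pstar + norm (cost (?K j) - Pstar)" by (rule norm_triangle_sub)
      also have "\<dots> \<le> norm Pstar + N * C"
        using dist[of j] mult_left_mono[OF c_le_C[of j] N] by linarith
      finally have P: "norm (cost (?K j)) < Pmax" by (simp add: Pmax_def)
      then have "norm (?K j) < \<kappa>" using \<kappa>(2) inv[of j] by (simp del: K_hat.simps)
      moreover have "invertible (block_uu (G_hat A B S R K1 \<Delta>G (Suc j)))"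
        using step[of "?K j" "c j" "\<Delta>G (Suc j)"] inv[of j] c_nonneg[of j] c_le_C[of j] \<Delta>G[of j] \<delta>(2)
        by (simp add: G_hat_def P_tilde_def del: K_hat.simps)
      ultimately show ?thesis using P inv[of j] by (simp add: P_tilde_def del: K_hat.simps)
    qed
    have c_decay: "c j \<le> \<rho> ^ j * C + b" for j
      using linear_recursion_bound[of \<rho> 0 c b j] \<rho>(1) noise b(1) by (simp add: c_0 c_Suc)
    have "(\<lambda>j. N * (\<rho> ^ j * C)) \<longlonglongrightarrow> N * (0 * C)"
      by (intro tendsto_intros LIMSEQ_realpow_zero \<rho>)
    then have "\<forall>\<^sub>F j in sequentially. N * (\<rho> ^ j * C) < \<epsilon> / 4"
      using \<epsilon> by (intro order_tendstoD(2)) auto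
    then have "\<forall>\<^sub>F j in sequentially. norm (cost (?K j) - Pstar) \<le> 3 * \<epsilon> / 4"
    proof (rule eventually_mono)
      fix j assume "N * (\<rho> ^ j * C) < \<epsilon> / 4"
      then show "norm (cost (?K j) - Pstar) \<le> 3 * \<epsilon> / 4"
        using dist[of j] mult_left_mono[OF c_decay[of j] N] Nb by (simp add: distrib_left)
    qed
    then have "\<forall>\<^sub>F i in sequentially. ereal (norm (P_tilde A B S R K1 \<Delta>G i - Pstar)) \<le> ereal (3 * \<epsilon> / 4)"
      by (subst eventually_sequentially_Suc[symmetric]) (simp add: P_tilde_def del: K_hat.simps)
    then have "limsup (\<lambda>i. ereal (norm (P_tilde A B S R K1 \<Delta>G i - Pstar))) \<le> ereal (3 * \<epsilon> / 4)"
      by (rule Limsup_bounded)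
    also have "\<dots> < ereal \<epsilon>" using \<epsilon> by simp
    finally have limsup: "limsup (\<lambda>i. ereal (norm (P_tilde A B S R K1 \<Delta>G i - Pstar))) < ereal \<epsilon>" .
    have lim: "(\<lambda>i. norm (P_tilde A B S R K1 \<Delta>G i - Pstar)) \<longlonglongrightarrow> 0" if "(\<lambda>i. norm (\<Delta>G i)) \<longlonglongrightarrow> 0"
    proof (rule LIMSEQ_imp_Suc)
      have "(\<lambda>j. L * norm (\<Delta>G (Suc j))) \<longlonglongrightarrow> L * 0"
        by (intro tendsto_mult_left LIMSEQ_Suc that)
      then have "c \<longlonglongrightarrow> 0"
        by (intro perturbed_contraction_tendsto_0[where d = "\<lambda>j. L * norm (\<Delta>G (Suc j))",
            OF \<rho> c_nonneg])
          (simp_all add: c_Suc)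
      then have Nc: "(\<lambda>j. N * c j) \<longlonglongrightarrow> 0" by (rule tendsto_mult_right_zero)
      show "(\<lambda>j. norm (P_tilde A B S R K1 \<Delta>G (Suc j) - Pstar)) \<longlonglongrightarrow> 0"
        by (rule tendsto_sandwich[OF _ _ tendsto_const Nc])
          (auto simp: P_tilde_def dist simp del: K_hat.simps)
    qed
    have "\<forall>i\<ge>1. invertible (block_uu (G_hat A B S R K1 \<Delta>G i)) \<and>
        stabilizing A B (K_hat A B S R K1 \<Delta>G i) \<and>
        norm (P_tilde A B S R K1 \<Delta>G i) < Pmax \<and> norm (K_hat A B S R K1 \<Delta>G i) < \<kappa>"
    proof (intro allI impI)
      fix i :: nat assume "1 \<le> i"
      then obtain j where "i = Suc j" by (cases i) auto
      then show "invertible (block_uu (G_hat A B S R K1 \<Delta>G i)) \<and>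
          stabilizing A B (K_hat A B S R K1 \<Delta>G i) \<and>
          norm (P_tilde A B S R K1 \<Delta>G i) < Pmax \<and> norm (K_hat A B S R K1 \<Delta>G i) < \<kappa>"
        using bounds[of j] by (simp only:)
    qed
    with limsup lim show ?thesis by blast
  qed
  show ?thesis
    by (rule that[OF \<delta>(1) Pmax \<kappa>(1)]) (use main in blast)+
qed

end

theorem theorem2:
  fixes A S :: "real ^ 'n ^ 'n"
    and B :: "real ^ 'm ^ 'n"
    and R :: "real ^ 'm ^ 'm"
    and K1 :: "real ^ 'n ^ 'm"
    and \<epsilon> :: real
  assumes "controllable A B"
    and "pos_semidef S"
    and "observable A (psd_sqrt S)"
    and "pos_def R"
    and "pos_def S"
    and "stabilizing A B K1"
    and "\<epsilon> > 0"
  shows "\<exists>\<delta>\<^sub>2 > 0. \<exists>Pmax > 0. \<exists>\<kappa> > 0.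
    \<forall>\<Delta>G :: nat \<Rightarrow> real ^ ('n::finite + 'm::finite) ^ ('n::finite + 'm::finite).
      (\<forall>i\<ge>1. sym_mat (\<Delta>G i)) \<and> sup_norm \<Delta>G < ereal \<delta>\<^sub>2 \<longrightarrow>
        (\<forall>i\<ge>1. invertible (block_uu (G_hat A B S R K1 \<Delta>G i))
           \<and> stabilizing A B (K_hat A B S R K1 \<Delta>G i)
           \<and> norm (P_tilde A B S R K1 \<Delta>G i) < Pmax
           \<and> norm (K_hat A B S R K1 \<Delta>G i) < \<kappa>)
      \<and> limsup (\<lambda>i. ereal (norm (P_tilde A B S R K1 \<Delta>G i - P_star A B S R))) < ereal \<epsilon>
      \<and> ((\<lambda>i. norm (\<Delta>G i)) \<longlonglongrightarrow> 0 \<longrightarrow>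
           (\<lambda>i. norm (P_tilde A B S R K1 \<Delta>G i - P_star A B S R)) \<longlonglongrightarrow> 0)"
proof -
  interpret stabilizable_lqr A S B R
    using assms by unfold_locales auto
  obtain \<delta> Pmax \<kappa> where pos: "0 < \<delta>" "0 < Pmax" "0 < \<kappa>"
    and bounds: "\<And>\<Delta>G i. sup_norm \<Delta>G < ereal \<delta> \<Longrightarrow> 1 \<le> i \<Longrightarrow>
      invertible (block_uu (G_hat A B S R K1 \<Delta>G i)) \<and>
      stabilizing A B (K_hat A B S R K1 \<Delta>G i) \<and>
      norm (P_tilde A B S R K1 \<Delta>G i) < Pmax \<and> norm (K_hat A B S R K1 \<Delta>G i) < \<kappa>"
    and limsup: "\<And>\<Delta>G. sup_norm \<Delta>G < ereal \<delta> \<Longrightarrow>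
      limsup (\<lambda>i. ereal (norm (P_tilde A B S R K1 \<Delta>G i - P_star A B S R))) < ereal \<epsilon>"
    and lim: "\<And>\<Delta>G. sup_norm \<Delta>G < ereal \<delta> \<Longrightarrow> (\<lambda>i. norm (\<Delta>G i)) \<longlonglongrightarrow> 0 \<Longrightarrow>
      (\<lambda>i. norm (P_tilde A B S R K1 \<Delta>G i - P_star A B S R)) \<longlonglongrightarrow> 0"
    by (rule inexact_policy_iteration_robust[OF \<open>stabilizing A B K1\<close> \<open>\<epsilon> > 0\<close>]) (rule that)
  show ?thesis
    by (rule exI[of _ \<delta>], rule conjI[OF pos(1)], rule exI[of _ Pmax], rule conjI[OF pos(2)],
        rule exI[of _ \<kappa>], rule conjI[OF pos(3)]) (use bounds limsup lim in blast)
qed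

end
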